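(* Let $(E,A,B)\in\mathbb{R}^{\ell\times n}\times\mathbb{R}^{\ell\times n}\times\mathbb{R}^{\ell\times m}$, let $S=S^\top\in\mathbb{R}^{(n+m)\times(n+m)}$, and let $F\in\mathbb{R}^{p\times n}$, $G\in\mathbb{R}^{p\times m}$ define the constraints $F x(t)+G u(t)\le \mathds{1}$ (componentwise, for almost all $t\ge 0$). Let $\widehat T$ be a regularizing transformation of $[E,A,B]$ with associated data $r,\hat n,q,X,\widehat A,\widehat B,\widehat S,\widehat Q,\widehat H,\widehat R$ (see context), suppose that the standing assumption (see context) holds, and let $\widehat P=\widehat P^\top>0$ be the solution of the algebraic Riccati equation $$\widehat A^\top\widehat P+\widehat P\widehat A+\widehat Q-(\widehat P\widehat B+\widehat H)\widehat R^{-1}(\widehat P\widehat B+\widehat H)^\top=0 .$$ Put $$M:=X\begin{bmatrix} I_{\hat n}\\ -\widehat R^{-1}(\widehat B^\top\widehat P+\widehat H^\top)\end{bmatrix}\in\mathbb{R}^{(n+m)\times\hat n},$$ assume $[F\ \ G]\,M\neq 0$, and define $$\rho:=\lambda_{\min}(\widehat P)\,\bigl\|[F\ \ G]\,M\bigr\|_\infty^{-2}>0 .$$ Then the set $$\mathbb{X}_{\mathrm f}:=\bigl\{[I_n,0]\,M\hat x \ \big|\ \hat x\in\mathbb{R}^{\hat n},\ \hat x^\top\widehat P\hat x\le\rho\bigr\}\subseteq\mathbb{R}^n$$ is controlled forward invariant with respect to $[E,A,B]$. Moreover, with $V_{\mathrm f}:=V_\infty$, the optimal solution satisfies the decrease condition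 almost everywhere: for every $\hat x\in\mathfrak{C}_{[E,A,B]}$, if $(x^*,u^* )\in\mathfrak{B}_{[E,A,B]}$ denotes the optimal solution of the infinite-horizon problem, i.e. $(Ex^* )(0)=E\hat x$ and $J_\infty(x^*,u^* )=V_\infty(\hat x)$, then for almost all $\delta>0$ $$V_{\mathrm f}(x^*(\delta))\le V_{\mathrm f}(\hat x)-\int_0^\delta\begin{pmatrix}x^*(t)\\ u^*(t)\end{pmatrix}^{\!\top}S\begin{pmatrix}x^*(t)\\ u^*(t)\end{pmatrix}\mathrm{d}t .$$
   Context: Functions are identified if they agree almost everywhere. $\mathcal{L}^1_{\mathrm{loc}}$ denotes locally integrable functions, $\mathcal{W}^{1,1}_{\mathrm{loc}}$ the functions in $\mathcal{L}^1_{\mathrm{loc}}$ with weak derivative in $\mathcal{L}^1_{\mathrm{loc}}$ (evaluated pointwise via the continuous representative). $\mathds{1}$ is the all-ones vector, $\lambda_{\min}$ the smallest eigenvalue, $\|\cdot\|_\infty$ of a matrix the maximal absolute row sum; for symmetric matrices $M>0$ ($M\ge0$) means positive (semi-)definite. Behaviour: $\mathfrak{B}_{[E,A,B]}$ is the set of all $(x,u)\in\mathcal{L}^1_{\mathrm{loc}}(\mathbb{R}_{\ge0},\mathbb{R}^{n+m})$ with $Ex\in\mathcal{W}^{1,1}_{\mathrm{loc}}(\mathbb{R}_{\ge0},\mathbb{R}^\ell)$ and $\frac{\mathrm d}{\mathrm dt}(Ex(t))=Ax(t)+Bu(t)$ for almost all $t\ge0$. The set $\mathfrak{C}_{[E,A,B]}\subseteq\mathbb{R}^n$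 of weakly consistent initial values consists of all $x^0$ for which some $(x,u)\in\mathfrak{B}_{[E,A,B]}$ satisfies $(Ex)(0)=Ex^0$. Controlled forward invariance: $\mathbb{X}_{\mathrm f}\subseteq\mathbb{R}^n$ is controlled forward invariant w.r.t. $[E,A,B]$ if for every $x^0\in\mathbb{X}_{\mathrm f}$ there is $(x,u)\in\mathfrak{B}_{[E,A,B]}$ with $(Ex)(0)=Ex^0$ and $x(t)\in\mathbb{X}_{\mathrm f}$ for almost all $t\ge0$. Cost and value function: $J_\infty(x,u)=\int_0^\infty\binom{x(t)}{u(t)}^\top S\binom{x(t)}{u(t)}\,\mathrm dt$ for $(x,u)\in\mathfrak{B}_{[E,A,B]}$, and $V_\infty(x^0)=\inf\{J_\infty(x,u)\mid (x,u)\in\mathfrak{B}_{[E,A,B]},\ (Ex)(0)=Ex^0\}$ for $x^0\in\mathfrak{C}_{[E,A,B]}$. Regularizing transformation: a matrix $\widehat T\in GL_{n+m}(\mathbb{R})$ for which there are integers $0\le\hat n\le r\le\ell$ with $\hat n\le n$, $r\le n+m$, a unimodular polynomial matrix $U(s)=sU_1+U_0\in\mathbb{R}[s]^{\ell\times\ell}$ (unimodular: polynomial inverse exists), and real matrices $A_{ij},B_i$ with $A_{22}\in GL_{r-\hat n}(\mathbb{R})$ such that $$[sE-A,-B]\,\widehat T=U(s)\begin{bmatrix}0&0&0\\ sI_{\hat n}-A_{11}&-A_{12}&-B_1\\ -A_{21}&-A_{22}&-B_2\end{bmatrix},$$ with row blocks of sizes $\ell-r,\hat n,r-\hat n$ and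 column blocks of sizes $\hat n,r-\hat n,q:=n+m-r$. Such data exist for every $[E,A,B]$. Associated data: $$\widehat A:=A_{11}-A_{12}A_{22}^{-1}A_{21},\quad \widehat B:=B_1-A_{12}A_{22}^{-1}B_2,\quad X:=\widehat T\begin{bmatrix}I_{\hat n}&0\\ -A_{22}^{-1}A_{21}&-A_{22}^{-1}B_2\\ 0&I_q\end{bmatrix},\quad \widehat S:=X^\top SX=\begin{bmatrix}\widehat Q&\widehat H\\ \widehat H^\top&\widehat R\end{bmatrix},$$ with $\widehat Q\in\mathbb{R}^{\hat n\times\hat n}$, $\widehat R\in\mathbb{R}^{q\times q}$. Standing assumption: $\widehat S\ge0$; $(\widehat A,\widehat B)$ is stabilizable; $\widehat R>0$; $(\widehat A,\widehat Q)$ is observable; $\operatorname{rank}\widehat S=\operatorname{rank}\widehat Q+\operatorname{rank}\widehat R$. Under this assumption the algebraic Riccati equation in the claim has a unique positive definite symmetric solution (a known fact), which is $\widehat P$, and for every $\hat x\in\mathfrak{C}_{[E,A,B]}$ the optimal solution $(x^*,u^* )$ exists and is unique. *)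

theory Defs
  imports
    "HOL-Analysis.Analysis"
    "Jordan_Normal_Form.Matrix"
    "Jordan_Normal_Form.Gauss_Jordan_Elimination"
    "Jordan_Normal_Form.Spectral_Radius"
    "Jordan_Normal_Form.DL_Rank"
begin

(* Several dimensions below are existentially chosen and may be 0, so matrices and vectors are
   those of Jordan_Normal_Form; the clashing syntax for type-indexed vectors is switched off. *)

unbundle no vec_syntax
unbundle no inner_syntax
subsection \<open>Matrices\<close>

abbreviation mat_inv :: "real mat \<Rightarrow> real mat" where
  "mat_inv A \<equiv> the (mat_inverse A)"

definition append_cols :: "'a :: zero mat \<Rightarrow> 'a mat \<Rightarrow> 'a mat" where
  "append_cols A B = four_block_mat A B (0\<^sub>m 0 (dim_col A)) (0\<^sub>m 0 (dim_col B))"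

definition pos_semidef :: "real mat \<Rightarrow> bool" where
  "pos_semidef A \<longleftrightarrow> square_mat A \<and> transpose_mat A = A \<and>
     (\<forall>x \<in> carrier_vec (dim_row A). 0 \<le> scalar_prod x (A *\<^sub>v x))"

definition pos_def :: "real mat \<Rightarrow> bool" where
  "pos_def A \<longleftrightarrow> square_mat A \<and> transpose_mat A = A \<and>
     (\<forall>x \<in> carrier_vec (dim_row A). x \<noteq> 0\<^sub>v (dim_row A) \<longrightarrow> 0 < scalar_prod x (A *\<^sub>v x))"

abbreviation mat_rank :: "real mat \<Rightarrow> nat" where
  "mat_rank A \<equiv> vec_space.rank (dim_row A) A"

text \<open>Only meaningful for symmetric matrices with at least one row.\<close>

definition lambda_min :: "real mat \<Rightarrow> real" where
  "lambda_min A = Min (spectrum A)"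

text \<open>Only meaningful for matrices with at least one row.\<close>

definition row_sum_norm :: "real mat \<Rightarrow> real" where
  "row_sum_norm A = Max ((\<lambda>i. \<Sum>j<dim_col A. \<bar>A $$ (i, j)\<bar>) ` {..<dim_row A})"

definition const_poly_mat :: "real mat \<Rightarrow> real poly mat" where
  "const_poly_mat A = map_mat (\<lambda>a. [:a:]) A"

text \<open>The polynomial matrix \<open>s M + N\<close>.\<close>

definition pencil :: "real mat \<Rightarrow> real mat \<Rightarrow> real poly mat" where
  "pencil M N = mat (dim_row M) (dim_col M) (\<lambda>(i, j). [:N $$ (i, j), M $$ (i, j):])"

subsection \<open>Function spaces on the half-line\<close>

text \<open>
  Functions on \<open>[0,\<infinity>)\<close> are represented by functions on the reals whose values at negative
  arguments are irrelevant. All notions below are invariant under changes on null sets.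
\<close>

definition L1loc :: "(real \<Rightarrow> real) \<Rightarrow> bool" where
  "L1loc f \<longleftrightarrow> (\<forall>T \<ge> 0. set_integrable lebesgue {0..T} f)"

definition test_function :: "(real \<Rightarrow> real) \<Rightarrow> bool" where
  "test_function \<phi> \<longleftrightarrow> (\<forall>k t. (deriv ^^ k) \<phi> field_differentiable at t) \<and>
     (\<exists>a b. 0 < a \<and> (\<forall>t. t \<notin> {a..b} \<longrightarrow> \<phi> t = 0))"

definition weak_derivative :: "(real \<Rightarrow> real) \<Rightarrow> (real \<Rightarrow> real) \<Rightarrow> bool" where
  "weak_derivative f g \<longleftrightarrow> (\<forall>\<phi>. test_function \<phi> \<longrightarrow>
     (LINT t:{0..}|lebesgue. f t * deriv \<phi> t) = - (LINT t:{0..}|lebesgue. g t * \<phi> t))"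

definition W11loc :: "(real \<Rightarrow> real) \<Rightarrow> bool" where
  "W11loc f \<longleftrightarrow> L1loc f \<and> (\<exists>g. L1loc g \<and> weak_derivative f g)"

definition continuous_rep :: "(real \<Rightarrow> real) \<Rightarrow> real \<Rightarrow> real" where
  "continuous_rep f =
     (SOME g. continuous_on {0..} g \<and> (AE t in lebesgue. 0 \<le> t \<longrightarrow> g t = f t))"

definition L1loc_vec :: "nat \<Rightarrow> (real \<Rightarrow> real Matrix.vec) \<Rightarrow> bool" where
  "L1loc_vec k f \<longleftrightarrow> (\<forall>t \<ge> 0. f t \<in> carrier_vec k) \<and> (\<forall>i<k. L1loc (\<lambda>t. f t $ i))"

definition W11loc_vec :: "nat \<Rightarrow> (real \<Rightarrow> real Matrix.vec) \<Rightarrow> bool" where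
  "W11loc_vec k f \<longleftrightarrow> (\<forall>t \<ge> 0. f t \<in> carrier_vec k) \<and> (\<forall>i<k. W11loc (\<lambda>t. f t $ i))"

definition weak_derivative_vec ::
    "nat \<Rightarrow> (real \<Rightarrow> real Matrix.vec) \<Rightarrow> (real \<Rightarrow> real Matrix.vec) \<Rightarrow> bool" where
  "weak_derivative_vec k f g \<longleftrightarrow> (\<forall>i<k. weak_derivative (\<lambda>t. f t $ i) (\<lambda>t. g t $ i))"

text \<open>Pointwise evaluation through the continuous representative.\<close>

definition eval_vec :: "nat \<Rightarrow> (real \<Rightarrow> real Matrix.vec) \<Rightarrow> real \<Rightarrow> real Matrix.vec" where
  "eval_vec k f t = Matrix.vec k (\<lambda>i. continuous_rep (\<lambda>s. f s $ i) t)"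

subsection \<open>Differential-algebraic systems \<open>d/dt (E x) = A x + B u\<close>\<close>

definition behaviour :: "real mat \<Rightarrow> real mat \<Rightarrow> real mat \<Rightarrow>
    ((real \<Rightarrow> real Matrix.vec) \<times> (real \<Rightarrow> real Matrix.vec)) set" where
  "behaviour E A B = {(x, u).
     L1loc_vec (dim_col E) x \<and> L1loc_vec (dim_col B) u \<and>
     W11loc_vec (dim_row E) (\<lambda>t. E *\<^sub>v x t) \<and>
     (\<exists>z. L1loc_vec (dim_row E) z \<and> weak_derivative_vec (dim_row E) (\<lambda>t. E *\<^sub>v x t) z \<and>
       (AE t in lebesgue. 0 \<le> t \<longrightarrow> z t = A *\<^sub>v x t + B *\<^sub>v u t))}"

text \<open>The condition \<open>(E x)(0) = E x0\<close>.\<close>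

definition initial_cond ::
    "real mat \<Rightarrow> (real \<Rightarrow> real Matrix.vec) \<Rightarrow> real Matrix.vec \<Rightarrow> bool" where
  "initial_cond E x x0 \<longleftrightarrow> eval_vec (dim_row E) (\<lambda>t. E *\<^sub>v x t) 0 = E *\<^sub>v x0"

definition consistent_initial :: "real mat \<Rightarrow> real mat \<Rightarrow> real mat \<Rightarrow> real Matrix.vec set" where
  "consistent_initial E A B = {x0 \<in> carrier_vec (dim_col E).
     \<exists>(x, u) \<in> behaviour E A B. initial_cond E x x0}"

definition controlled_forward_invariant ::
    "real mat \<Rightarrow> real mat \<Rightarrow> real mat \<Rightarrow> real Matrix.vec set \<Rightarrow> bool" where
  "controlled_forward_invariant E A B Xf \<longleftrightarrow> Xf \<subseteq> carrier_vec (dim_col E) \<and>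
     (\<forall>x0 \<in> Xf. \<exists>(x, u) \<in> behaviour E A B. initial_cond E x x0 \<and>
       (AE t in lebesgue. 0 \<le> t \<longrightarrow> x t \<in> Xf))"

subsection \<open>Cost and value function\<close>

text \<open>
  The Lebesgue integral as an extended real, integral of the positive part minus integral of the
  negative part. If both are infinite, the value is \<open>\<infinity>\<close>.
\<close>

definition ext_integral :: "real set \<Rightarrow> (real \<Rightarrow> real) \<Rightarrow> ereal" where
  "ext_integral D f =
     enn2ereal (\<integral>\<^sup>+ t \<in> D. ennreal (f t) \<partial>lebesgue) -
     enn2ereal (\<integral>\<^sup>+ t \<in> D. ennreal (- f t) \<partial>lebesgue)"

definition stage_cost :: "real mat \<Rightarrow> real Matrix.vec \<Rightarrow> real Matrix.vec \<Rightarrow> real" where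
  "stage_cost S x u = scalar_prod (x @\<^sub>v u) (S *\<^sub>v (x @\<^sub>v u))"

definition cost_on :: "real set \<Rightarrow> real mat \<Rightarrow>
    (real \<Rightarrow> real Matrix.vec) \<Rightarrow> (real \<Rightarrow> real Matrix.vec) \<Rightarrow> ereal" where
  "cost_on D S x u = ext_integral D (\<lambda>t. stage_cost S (x t) (u t))"

abbreviation J_inf ::
    "real mat \<Rightarrow> (real \<Rightarrow> real Matrix.vec) \<Rightarrow> (real \<Rightarrow> real Matrix.vec) \<Rightarrow> ereal" where
  "J_inf S x u \<equiv> cost_on {0..} S x u"

definition V_inf ::
    "real mat \<Rightarrow> real mat \<Rightarrow> real mat \<Rightarrow> real mat \<Rightarrow> real Matrix.vec \<Rightarrow> ereal" where
  "V_inf E A B S x0 =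
     Inf {J_inf S x u | x u. (x, u) \<in> behaviour E A B \<and> initial_cond E x x0}"

subsection \<open>Regularizing transformations\<close>

definition regularizing_transformation :: "nat \<Rightarrow> nat \<Rightarrow> nat \<Rightarrow>
    real mat \<Rightarrow> real mat \<Rightarrow> real mat \<Rightarrow> real mat \<Rightarrow> nat \<Rightarrow> nat \<Rightarrow> real mat \<Rightarrow> real mat \<Rightarrow>
    real mat \<Rightarrow> real mat \<Rightarrow> real mat \<Rightarrow> real mat \<Rightarrow> real mat \<Rightarrow> real mat \<Rightarrow> bool" where
  "regularizing_transformation l n m E A B T nh r U1 U0 A11 A12 A21 A22 B1 B2 \<longleftrightarrow>
     nh \<le> r \<and> r \<le> l \<and> nh \<le> n \<and> r \<le> n + m \<and>
     T \<in> carrier_mat (n + m) (n + m) \<and> invertible_mat T \<and>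
     U1 \<in> carrier_mat l l \<and> U0 \<in> carrier_mat l l \<and> invertible_mat (pencil U1 U0) \<and>
     A11 \<in> carrier_mat nh nh \<and> A12 \<in> carrier_mat nh (r - nh) \<and>
     A21 \<in> carrier_mat (r - nh) nh \<and> A22 \<in> carrier_mat (r - nh) (r - nh) \<and>
     invertible_mat A22 \<and>
     B1 \<in> carrier_mat nh (n + m - r) \<and> B2 \<in> carrier_mat (r - nh) (n + m - r) \<and>
     append_cols (pencil E (- A)) (const_poly_mat (- B)) * const_poly_mat T =
       pencil U1 U0 *
         (0\<^sub>m (l - r) (n + m) @\<^sub>r
          four_block_mat
            (pencil (1\<^sub>m nh) (- A11)) (const_poly_mat (append_cols (- A12) (- B1)))
            (const_poly_mat (- A21))  (const_poly_mat (append_cols (- A22) (- B2))))"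

subsection \<open>Stabilizability and observability of ordinary systems\<close>

text \<open>Some state feedback places all complex closed-loop eigenvalues in the open left half-plane.\<close>

definition stabilizable :: "real mat \<Rightarrow> real mat \<Rightarrow> bool" where
  "stabilizable A B \<longleftrightarrow> (\<exists>K \<in> carrier_mat (dim_col B) (dim_row A).
     \<forall>z. eigenvalue (map_mat complex_of_real (A + B * K)) z \<longrightarrow> Re z < 0)"

text \<open>Every trajectory of \<open>x' = A x\<close> with vanishing output \<open>C x\<close> vanishes.\<close>

definition observable :: "real mat \<Rightarrow> real mat \<Rightarrow> bool" where
  "observable A C \<longleftrightarrow> (\<forall>x.
     (\<forall>t \<ge> 0. x t \<in> carrier_vec (dim_row A) \<and> C *\<^sub>v x t = 0\<^sub>v (dim_row C) \<and>
        (\<forall>i < dim_row A. ((\<lambda>s. x s $ i) has_real_derivative (A *\<^sub>v x t) $ i) (at t within {0..})))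
     \<longrightarrow> (\<forall>t \<ge> 0. x t = 0\<^sub>v (dim_row A)))"

end

theory Submission
  imports Defs
begin

text \<open>
  The set \<open>Xf\<close> is the image of an ellipsoid \<open>{\<xi>. \<xi> \<bullet> P \<xi> \<le> \<rho>}\<close>, where \<open>P\<close> solves the Riccati equation.
  The regularizing transformation reduces the differential-algebraic system to the ordinary system
  \<open>\<xi>' = Ah \<xi> + Bh v\<close>: comparing coefficients of powers of \<open>s\<close> in the defining identity of polynomial
  matrices gives a matrix \<open>N\<close> with \<open>E x = N \<xi>\<close> and \<open>A x + B u = N (Ah \<xi> + Bh v)\<close> whenever
  \<open>(x, u) = X (\<xi>, v)\<close> (lemma \<open>regularized_system_equation\<close>). Hence the solutions of the closed loop with
  the Riccati feedback \<open>v = - K \<xi>\<close> are carried to trajectories of the given system. Along the closed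
  loop the derivative of \<open>\<xi> \<bullet> P \<xi>\<close> is minus the stage cost, which is nonnegative because the
  transformed cost matrix is positive semidefinite (\<open>riccati_feedback_dissipative\<close>). So the ellipsoid
  is invariant, and \<open>sublevel_set_controlled_forward_invariant\<close> transports this to \<open>Xf\<close>. The number
  \<open>\<rho>\<close> is positive because a symmetric positive definite matrix has an eigenvalue, and only positive
  ones.
  
  The decrease condition is dynamic programming: the tail of an optimal trajectory from time \<open>\<delta>\<close> on
  competes in the infimum that defines the value at \<open>x \<delta>\<close>. The delicate point is that the tail must
  satisfy the initial condition \<open>(E x)(0) = E (x \<delta>)\<close>, which is read off the continuous representative
  of \<open>E x\<close>. This representative exists since a locally integrable function whose weak derivative is
  locally integrable is, up to a constant and a null set, the integral of that derivative. This is
  the lemma of du Bois-Reymond on the half-line, proved here with explicit bump functions; at almost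
  every \<open>\<delta>\<close> the representative has the value \<open>E (x \<delta>)\<close>.
\<close>

section \<open>Smooth functions and test functions\<close>

text \<open>
  Smoothness as \<open>k\<close>-fold differentiability for every \<open>k\<close>, where the first derivative is peeled off:
  in this form sums, products and affine substitutions are handled by induction on \<open>k\<close>, which is
  awkward for the iterated operator \<open>deriv ^^ k\<close>.
\<close>

fun times_diff :: "nat \<Rightarrow> (real \<Rightarrow> real) \<Rightarrow> bool" where
  "times_diff 0 f \<longleftrightarrow> True"
| "times_diff (Suc k) f \<longleftrightarrow> (\<exists>f'. (\<forall>t. (f has_real_derivative f' t) (at t)) \<and> times_diff k f')"

lemma times_diff_SucI:
  "(\<And>t. (f has_real_derivative f' t) (at t)) \<Longrightarrow> times_diff k f' \<Longrightarrow> times_diff (Suc k) f"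
  by (auto intro!: exI[of _ f'])

lemma times_diff_deriv: "times_diff (Suc k) f \<Longrightarrow> times_diff k (deriv f)"
proof -
  assume "times_diff (Suc k) f"
  then obtain f' where f': "\<And>t. (f has_real_derivative f' t) (at t)" "times_diff k f'" by auto
  have "deriv f = f'" using f'(1) by (auto intro: DERIV_imp_deriv)
  with f' show ?thesis by simp
qed

lemma times_diff_has_deriv: "times_diff (Suc k) f \<Longrightarrow> (f has_real_derivative deriv f t) (at t)"
  by (auto simp: DERIV_deriv_iff_field_differentiable field_differentiable_def)

lemma times_diff_iterate: "times_diff (k + j) f \<Longrightarrow> times_diff j ((deriv ^^ k) f)"
proof (induction k arbitrary: f)
  case (Suc k)
  then have "times_diff (k + j) (deriv f)" using times_diff_deriv by simp
  from Suc.IH[OF this] show ?case by (simp add: funpow_swap1)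
qed simp

lemma times_diff_of_iterates:
  assumes "\<And>k t. (deriv ^^ k) f field_differentiable at t"
  shows "times_diff n f"
  using assms
proof (induction n arbitrary: f)
  case (Suc n)
  have "times_diff n (deriv f)"
  proof (rule Suc.IH)
    fix k t show "(deriv ^^ k) (deriv f) field_differentiable at t"
      using Suc.prems[of "Suc k" t] by (simp add: funpow_swap1)
  qed
  have "(f has_real_derivative deriv f t) (at t)" for t
    using Suc.prems[of 0 t] by (simp add: DERIV_deriv_iff_field_differentiable)
  then show ?case using \<open>times_diff n (deriv f)\<close> by (rule times_diff_SucI)
qed simp

lemma test_function_iff:
  "test_function \<phi> \<longleftrightarrow> (\<forall>k. times_diff k \<phi>) \<and> (\<exists>a b. 0 < a \<and> (\<forall>t. t \<notin> {a..b} \<longrightarrow> \<phi> t = 0))"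
proof -
  have "(\<forall>k t. (deriv ^^ k) \<phi> field_differentiable at t) \<longleftrightarrow> (\<forall>k. times_diff k \<phi>)"
  proof
    assume R: "\<forall>k. times_diff k \<phi>"
    show "\<forall>k t. (deriv ^^ k) \<phi> field_differentiable at t"
    proof (intro allI)
      fix k t
      have "times_diff (Suc 0) ((deriv ^^ k) \<phi>)" using times_diff_iterate R by blast
      then show "(deriv ^^ k) \<phi> field_differentiable at t"
        by (auto simp: field_differentiable_def)
    qed
  qed (use times_diff_of_iterates in blast)
  then show ?thesis unfolding test_function_def by simp
qed

lemma test_functionI:
  assumes "\<And>k. times_diff k \<phi>" "0 < a" "\<And>t. t < a \<Longrightarrow> \<phi> t = 0" "\<And>t. b < t \<Longrightarrow> \<phi> t = 0"
  shows "test_function \<phi>"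
proof -
  have "\<phi> t = 0" if "t \<notin> {a..b}" for t using that assms(3,4)[of t] by fastforce
  with assms(1,2) show ?thesis unfolding test_function_iff by blast
qed

lemma times_diff_mono: "times_diff (Suc k) f \<Longrightarrow> times_diff k f"
proof (induction k arbitrary: f)
  case (Suc k)
  then obtain f' where "\<And>t. (f has_real_derivative f' t) (at t)" "times_diff (Suc k) f'"
    unfolding times_diff.simps(2)[of "Suc k"] by blast
  then show ?case using Suc.IH[of f'] by (intro times_diff_SucI[of f f']) auto
qed simp

lemma times_diff_add: "times_diff k f \<Longrightarrow> times_diff k g \<Longrightarrow> times_diff k (\<lambda>t. f t + g t)"
proof (induction k arbitrary: f g)
  case (Suc k)
  then obtain f' g' where d: "\<And>t. (f has_real_derivative f' t) (at t)" "times_diff k f'"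
    "\<And>t. (g has_real_derivative g' t) (at t)" "times_diff k g'" by auto
  have "((\<lambda>t. f t + g t) has_real_derivative f' t + g' t) (at t)" for t
    using d by (intro DERIV_add)
  then show ?case using Suc.IH[OF d(2,4)] by (rule times_diff_SucI)
qed simp

lemma times_diff_mult: "times_diff k f \<Longrightarrow> times_diff k g \<Longrightarrow> times_diff k (\<lambda>t. f t * g t)"
proof (induction k arbitrary: f g)
  case (Suc k)
  then obtain f' g' where d: "\<And>t. (f has_real_derivative f' t) (at t)" "times_diff k f'"
    "\<And>t. (g has_real_derivative g' t) (at t)" "times_diff k g'" by auto
  have "times_diff k (\<lambda>t. f' t * g t + g' t * f t)"
    by (rule times_diff_add[OF Suc.IH[OF d(2) times_diff_mono[OF Suc.prems(2)]]
          Suc.IH[OF d(4) times_diff_mono[OF Suc.prems(1)]]])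
  have "((\<lambda>t. f t * g t) has_real_derivative f' t * g t + g' t * f t) (at t)" for t
    using d by (intro DERIV_mult)
  then show ?case using \<open>times_diff k (\<lambda>t. f' t * g t + g' t * f t)\<close> by (rule times_diff_SucI)
qed simp

lemma times_diff_const: "times_diff k (\<lambda>t. c)"
  by (induction k arbitrary: c) (auto intro!: exI[of _ "\<lambda>t. 0"])

lemma times_diff_affine: "times_diff k f \<Longrightarrow> times_diff k (\<lambda>t. f (c * t + d))"
proof (induction k arbitrary: f)
  case (Suc k)
  then obtain f' where d: "\<And>t. (f has_real_derivative f' t) (at t)" "times_diff k f'" by auto
  have "times_diff k (\<lambda>t. c * f' (c * t + d))"
    using d Suc.IH by (intro times_diff_mult times_diff_const) auto
  have "((\<lambda>t. f (c * t + d)) has_real_derivative c * f' (c * t + d)) (at t)" for t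
  proof -
    have "((\<lambda>t. c * t + d) has_real_derivative c) (at t)"
      by (auto intro!: derivative_eq_intros)
    from DERIV_chain2[OF d(1) this] show ?thesis by (simp add: mult.commute)
  qed
  then show ?case using \<open>times_diff k (\<lambda>t. c * f' (c * t + d))\<close> by (rule times_diff_SucI)
qed simp

lemma poly_times_exp_tendsto_0:
  "((\<lambda>t::real. poly p (1 / t) * exp (- (1 / t))) \<longlongrightarrow> 0) (at_right 0)"
proof -
  have "((\<lambda>s::real. \<Sum>i\<le>degree p. coeff p i * (s ^ i / exp s)) \<longlongrightarrow> (\<Sum>i\<le>degree p. coeff p i * 0)) at_top"
    by (intro tendsto_sum tendsto_mult tendsto_const tendsto_power_div_exp_0)
  moreover have "(\<lambda>s::real. \<Sum>i\<le>degree p. coeff p i * (s ^ i / exp s)) = (\<lambda>s. poly p s * exp (- s))"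
    by (simp add: poly_altdef sum_distrib_right exp_minus divide_inverse mult.assoc)
  ultimately have lim: "((\<lambda>s::real. poly p s * exp (- s)) \<longlongrightarrow> 0) at_top" by simp
  have "filterlim (\<lambda>t::real. 1 / t) at_top (at_right 0)"
    using filterlim_inverse_at_top_right by (simp add: divide_inverse)
  from filterlim_compose[OF lim this] show ?thesis .
qed

text \<open>
  For \<open>t > 0\<close> the derivative of \<open>p(1/t) exp(-1/t)\<close> is again of this form, with the polynomial
  \<open>s\<^sup>2 (p - p')\<close> in place of \<open>p\<close>, and all these functions are flat at \<open>0\<close>. Smoothness of
  \<open>exp(-1/t)\<close> therefore follows by an induction that ranges over all \<open>p\<close>.
\<close>

definition flat_exp :: "real poly \<Rightarrow> real \<Rightarrow> real" where
  "flat_exp p t = (if 0 < t then poly p (1 / t) * exp (- (1 / t)) else 0)"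

lemma flat_exp_has_derivative:
  "(flat_exp p has_real_derivative flat_exp ([:0, 0, 1:] * (p - pderiv p)) t) (at t)"
proof -
  consider "t > 0" | "t < 0" | "t = 0" by linarith
  then show ?thesis
  proof cases
    case 1
    have "((\<lambda>t. poly p (1 / t) * exp (- (1 / t))) has_real_derivative
        flat_exp ([:0, 0, 1:] * (p - pderiv p)) t) (at t)"
      using 1 by (auto intro!: derivative_eq_intros DERIV_chain2[OF poly_DERIV]
          simp: flat_exp_def field_simps power2_eq_square)
    moreover have "\<forall>\<^sub>F s in nhds t. flat_exp p s = poly p (1 / s) * exp (- (1 / s))"
      using eventually_nhds_in_open[of "{0<..}" t] 1 by (auto elim!: eventually_mono simp: flat_exp_def)
    ultimately show ?thesis using DERIV_cong_ev[of t t "flat_exp p"] by simp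
  next
    case 2
    moreover have "\<forall>\<^sub>F s in nhds t. flat_exp p s = 0"
      using eventually_nhds_in_open[of "{..<0}" t] 2 by (auto elim!: eventually_mono simp: flat_exp_def)
    ultimately show ?thesis using DERIV_cong_ev[of t t "flat_exp p" "\<lambda>_. 0" 0 0]
      by (simp add: flat_exp_def)
  next
    case 3
    have "((\<lambda>h. flat_exp p h / h) \<longlongrightarrow> 0) (at_right 0)"
    proof (rule Lim_transform_eventually[OF poly_times_exp_tendsto_0[of "[:0, 1:] * p"]])
      show "\<forall>\<^sub>F h in at_right 0. poly ([:0, 1:] * p) (1 / h) * exp (- (1 / h)) = flat_exp p h / h"
        using eventually_at_right_less[of "0::real"]
        by (auto elim!: eventually_mono simp: flat_exp_def)
    qed
    moreover have "((\<lambda>h. flat_exp p h / h) \<longlongrightarrow> 0) (at_left 0)"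
    proof (rule Lim_transform_eventually[OF tendsto_const])
      show "\<forall>\<^sub>F h in at_left 0. 0 = flat_exp p h / h"
        using eventually_at_left_real[of "-1" "0::real"]
        by (auto elim!: eventually_mono simp: flat_exp_def)
    qed
    ultimately have "((\<lambda>h. flat_exp p h / h) \<longlongrightarrow> 0) (at 0)" by (simp add: filterlim_split_at)
    then show ?thesis using 3 by (simp add: has_field_derivative_iff flat_exp_def)
  qed
qed

lemma times_diff_flat_exp: "times_diff k (flat_exp p)"
proof (induction k arbitrary: p)
  case (Suc k)
  then show ?case using flat_exp_has_derivative by (intro times_diff_SucI)
qed simp

text \<open>
  For growing \<open>k\<close> the bump rises to the indicator function of \<open>(a, b)\<close> without leaving that interval.
  Such bumps replace normalized mollifiers below. The factor \<open>Suc k\<close> keeps the scaling nonzero.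
\<close>

definition bump :: "real \<Rightarrow> real \<Rightarrow> nat \<Rightarrow> real \<Rightarrow> real" where
  "bump a b k t = flat_exp 1 (real (Suc k) * (t - a)) * flat_exp 1 (real (Suc k) * (b - t))"

lemma bump_eq_0: "t \<notin> {a<..<b} \<Longrightarrow> bump a b k t = 0"
  by (auto simp: bump_def flat_exp_def zero_less_mult_iff)

lemma bump_bounds: "0 \<le> bump a b k t" "bump a b k t \<le> 1"
proof -
  have "0 \<le> flat_exp 1 t \<and> flat_exp 1 t \<le> 1" for t by (auto simp: flat_exp_def)
  then show "0 \<le> bump a b k t" "bump a b k t \<le> 1"
    by (auto simp: bump_def intro!: mult_le_one)
qed

lemma bump_pos: "t \<in> {a<..<b} \<Longrightarrow> 0 < bump a b k t"
  by (auto simp: bump_def flat_exp_def zero_less_mult_iff)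

lemma test_function_bump: "0 < a \<Longrightarrow> test_function (bump a b k)"
proof -
  assume "0 < a"
  have *: "bump a b k = (\<lambda>t. flat_exp 1 (real (Suc k) * t + (- real (Suc k) * a)) *
      flat_exp 1 (- real (Suc k) * t + real (Suc k) * b))"
    by (auto simp: bump_def algebra_simps fun_eq_iff)
  have "times_diff j (bump a b k)" for j
    unfolding * by (intro times_diff_mult times_diff_affine times_diff_flat_exp)
  then show ?thesis using \<open>0 < a\<close>
    by (rule test_functionI[where a = a and b = b]) (auto intro!: bump_eq_0)
qed

lemma bump_tendsto_indicator: "(\<lambda>k. bump a b k t) \<longlonglongrightarrow> indicator {a<..<b} t"
proof (cases "t \<in> {a<..<b}")
  case True
  have lim: "(\<lambda>k. exp (- (1 / (real (Suc k) * c)))) \<longlonglongrightarrow> 1" if "0 < c" for c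
  proof -
    have "(\<lambda>k. 1 / real (Suc k) * (1 / c)) \<longlonglongrightarrow> 0 * (1 / c)"
      by (intro tendsto_mult tendsto_const) (use LIMSEQ_inverse_real_of_nat in \<open>simp add: divide_inverse\<close>)
    then have "(\<lambda>k. exp (- (1 / real (Suc k) * (1 / c)))) \<longlonglongrightarrow> exp (- 0)"
      by (intro tendsto_exp tendsto_minus) simp
    then show ?thesis by simp
  qed
  have "(\<lambda>k. exp (- (1 / (real (Suc k) * (t - a)))) * exp (- (1 / (real (Suc k) * (b - t))))) \<longlonglongrightarrow> 1 * 1"
    by (intro tendsto_mult lim) (use True in auto)
  moreover have "bump a b k t =
      exp (- (1 / (real (Suc k) * (t - a)))) * exp (- (1 / (real (Suc k) * (b - t))))" for k
    using True by (simp add: bump_def flat_exp_def zero_less_mult_iff)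
  ultimately show ?thesis using True by simp
next
  case False
  then show ?thesis by (simp add: bump_eq_0)
qed

lemma test_function_has_deriv: "test_function \<phi> \<Longrightarrow> (\<phi> has_real_derivative deriv \<phi> t) (at t)"
  unfolding test_function_iff using times_diff_has_deriv by blast

lemma test_function_continuous: "test_function \<phi> \<Longrightarrow> continuous_on UNIV \<phi>"
  using test_function_has_deriv DERIV_continuous_on by blast

lemma test_function_supp:
  assumes "test_function \<phi>"
  obtains a b where "0 < a" "a < b" "\<And>t. t \<le> a \<Longrightarrow> \<phi> t = 0" "\<And>t. b \<le> t \<Longrightarrow> \<phi> t = 0"
proof -
  obtain a b where ab: "0 < a" "\<And>t. t \<notin> {a..b} \<Longrightarrow> \<phi> t = 0"
    using assms unfolding test_function_iff by blast
  show ?thesis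
  proof (rule that[of "a / 2" "max a b + 1"])
    show "\<phi> t = 0" if "t \<le> a / 2" for t using that ab by (intro ab(2)) auto
    show "\<phi> t = 0" if "max a b + 1 \<le> t" for t using that by (intro ab(2)) auto
  qed (use ab(1) in auto)
qed

lemma test_function_deriv: "test_function \<phi> \<Longrightarrow> test_function (deriv \<phi>)"
proof -
  assume t: "test_function \<phi>"
  then obtain a b where ab: "0 < a" "\<And>t. t \<notin> {a..b} \<Longrightarrow> \<phi> t = 0"
    unfolding test_function_iff by blast
  have "deriv \<phi> t = 0" if "t \<notin> {a..b}" for t
  proof -
    have "open (- {a..b})" by (intro open_Compl closed_atLeastAtMost)
    then have "\<forall>\<^sub>F s in nhds t. s \<in> - {a..b}"
      using that by (intro eventually_nhds_in_open) auto
    then have "\<forall>\<^sub>F s in nhds t. \<phi> s = 0"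
      by (rule eventually_mono) (use ab(2) in simp)
    then have "(\<phi> has_real_derivative 0) (at t)"
      using DERIV_cong_ev[of t t \<phi> "\<lambda>_. 0" 0 0] by simp
    then show ?thesis by (rule DERIV_imp_deriv)
  qed
  with t ab(1) show ?thesis unfolding test_function_iff using times_diff_deriv by blast
qed

lemma test_function_linear:
  assumes "test_function \<phi>" "test_function \<psi>"
  shows "test_function (\<lambda>t. \<phi> t + c * \<psi> t)"
proof -
  obtain a b where 1: "0 < a" "a < b" "\<And>t. t \<le> a \<Longrightarrow> \<phi> t = 0" "\<And>t. b \<le> t \<Longrightarrow> \<phi> t = 0"
    using test_function_supp assms(1) by blast
  obtain a' b' where 2: "0 < a'" "a' < b'" "\<And>t. t \<le> a' \<Longrightarrow> \<psi> t = 0" "\<And>t. b' \<le> t \<Longrightarrow> \<psi> t = 0"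
    using test_function_supp assms(2) by blast
  have "times_diff k (\<lambda>t. \<phi> t + c * \<psi> t)" for k
    using assms unfolding test_function_iff by (intro times_diff_add times_diff_mult times_diff_const) auto
  then show ?thesis
    by (rule test_functionI[where a = "min a a'" and b = "max b b'"]) (use 1 2 in simp_all)
qed

lemma test_function_shift:
  assumes "test_function \<phi>" "0 \<le> d"
  shows "test_function (\<lambda>t. \<phi> (t - d))"
proof -
  obtain a b where 1: "0 < a" "a < b" "\<And>t. t \<le> a \<Longrightarrow> \<phi> t = 0" "\<And>t. b \<le> t \<Longrightarrow> \<phi> t = 0"
    using test_function_supp assms(1) by blast
  have "times_diff k (\<lambda>t. \<phi> (1 * t + - d))" for k
    using assms unfolding test_function_iff by (intro times_diff_affine) auto
  then have "times_diff k (\<lambda>t. \<phi> (t - d))" for k by simp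
  then show ?thesis
    by (rule test_functionI[where a = "a + d" and b = "b + d"]) (use 1 assms(2) in simp_all)
qed

text \<open>
  A vanishing mean makes the primitive return to its initial value to the right of the support, so
  that one constant can be subtracted to give it compact support.
\<close>

lemma test_function_primitive:
  assumes t: "test_function \<psi>" and 0: "(LINT t|lborel. \<psi> t) = 0"
  obtains \<phi> where "test_function \<phi>" "deriv \<phi> = \<psi>"
proof -
  obtain a b where ab: "0 < a" "a < b" "\<And>t. t \<le> a \<Longrightarrow> \<psi> t = 0" "\<And>t. b \<le> t \<Longrightarrow> \<psi> t = 0"
    using test_function_supp t by blast
  have cont: "isCont \<psi> t" for t
    using test_function_has_deriv[OF t] DERIV_isCont by blast
  obtain F where F: "\<And>t. (F has_real_derivative \<psi> t) (at t)"
    using einterval_antiderivative[of "-\<infinity>" "\<infinity>" \<psi>] cont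
    by (auto simp: has_real_derivative_iff_has_vector_derivative)
  have const: "F s = F t" if "s < t" and 0: "\<And>z. s < z \<Longrightarrow> z < t \<Longrightarrow> \<psi> z = 0" for s t
    using MVT2[OF \<open>s < t\<close>, of F \<psi>] F 0 by auto
  have left: "F t = F a" if "t \<le> a" for t
    using const[of t a] that ab(3) by (cases "t = a") auto
  have right: "F t = F b" if "b \<le> t" for t
    using const[of b t] that ab(4) by (cases "t = b") auto
  have "(LINT t|lborel. \<psi> t * indicator {a..b} t) = F b - F a"
    using integral_FTC_Icc_real[of a b F \<psi>] F cont ab by simp
  moreover have "(\<lambda>t. \<psi> t * indicator {a..b} t) = \<psi>"
  proof
    fix t show "\<psi> t * indicator {a..b} t = \<psi> t"
      using ab(3)[of t] ab(4)[of t]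
      by (cases "t \<le> a"; cases "b \<le> t") (auto simp: indicator_def)
  qed
  ultimately have eq: "F b = F a" using 0 by simp
  let ?\<phi> = "\<lambda>t. F t - F a"
  have d: "(?\<phi> has_real_derivative \<psi> t) (at t)" for t
    using F by (auto intro!: derivative_eq_intros)
  have "times_diff k ?\<phi>" for k
  proof (rule times_diff_mono, rule times_diff_SucI)
    show "(?\<phi> has_real_derivative \<psi> t) (at t)" for t by (rule d)
    show "times_diff k \<psi>" using t unfolding test_function_iff by blast
  qed
  moreover have "?\<phi> t = 0" if "t \<notin> {a..b}" for t
    using that left[of t] right[of t] eq by auto
  ultimately have "test_function ?\<phi>" unfolding test_function_iff using ab by blast
  moreover have "deriv ?\<phi> = \<psi>" using d by (auto intro: DERIV_imp_deriv)
  ultimately show ?thesis by (rule that)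
qed

section \<open>Weak derivatives and continuous representatives\<close>

lemma borel_measurable_lebesgue_continuous:
  "continuous_on UNIV f \<Longrightarrow> f \<in> borel_measurable lebesgue" for f :: "real \<Rightarrow> real"
  by (intro measurable_completion) (simp add: borel_measurable_continuous_onI)

lemma continuous_bounded_Icc:
  fixes f :: "real \<Rightarrow> real"
  assumes "continuous_on UNIV f"
  obtains C where "\<And>t. t \<in> {0..b} \<Longrightarrow> \<bar>f t\<bar> \<le> C"
proof -
  have "compact (f ` {0..b})"
    using assms by (intro compact_continuous_image) (auto intro: continuous_on_subset)
  then have "bounded (f ` {0..b})" by (rule compact_imp_bounded)
  then obtain C where "\<forall>y \<in> f ` {0..b}. norm y \<le> C" unfolding bounded_iff ..
  then show ?thesis by (intro that[of C]) auto
qed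

lemma borel_measurable_lebesgue_indicator:
  "S \<in> sets borel \<Longrightarrow> (indicator S :: real \<Rightarrow> real) \<in> borel_measurable lebesgue"
  by (rule measurable_completion) simp

lemma L1loc_times_continuous:
  assumes f: "L1loc f" and c: "continuous_on UNIV \<phi>" and b: "0 \<le> b" "\<And>t. b < t \<Longrightarrow> \<phi> t = 0"
  shows "set_integrable lebesgue {0..} (\<lambda>t. f t * \<phi> t)"
proof -
  have fi: "integrable lebesgue (\<lambda>t. indicator {0..b} t * f t)"
    using f b(1) unfolding L1loc_def set_integrable_def by simp
  obtain C where C: "\<And>t. t \<in> {0..b} \<Longrightarrow> \<bar>\<phi> t\<bar> \<le> C"
    using continuous_bounded_Icc[OF c] by blast
  have "integrable lebesgue (\<lambda>t. indicator {0..b} t * f t * \<phi> t)"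
  proof (rule Bochner_Integration.integrable_bound)
    show "integrable lebesgue (\<lambda>t. C * (indicator {0..b} t * f t))"
      using fi by simp
    show "(\<lambda>t. indicator {0..b} t * f t * \<phi> t) \<in> borel_measurable lebesgue"
      using borel_measurable_integrable[OF fi] borel_measurable_lebesgue_continuous[OF c]
      by (rule borel_measurable_times)
    show "AE t in lebesgue. norm (indicator {0..b} t * f t * \<phi> t) \<le> norm (C * (indicator {0..b} t * f t))"
    proof (rule AE_I2)
      fix t
      show "norm (indicator {0..b} t * f t * \<phi> t) \<le> norm (C * (indicator {0..b} t * f t))"
      proof (cases "t \<in> {0..b}")
        case True
        then have "\<bar>f t\<bar> * \<bar>\<phi> t\<bar> \<le> \<bar>f t\<bar> * \<bar>C\<bar>"
          using C[OF True] by (intro mult_left_mono) auto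
        with True show ?thesis by (simp add: abs_mult mult.commute)
      qed simp
    qed
  qed
  moreover have "(\<lambda>t. indicator {0..b} t * f t * \<phi> t) = (\<lambda>t. indicator {0..} t *\<^sub>R (f t * \<phi> t))"
  proof
    fix t show "indicator {0..b} t * f t * \<phi> t = indicator {0..} t *\<^sub>R (f t * \<phi> t)"
      using b(2)[of t] by (cases "b < t") (auto simp: indicator_def)
  qed
  ultimately show ?thesis unfolding set_integrable_def by simp
qed

lemma test_function_supp_deriv:
  assumes "test_function \<phi>"
  obtains b where "0 < b" "\<And>t. t \<le> 0 \<Longrightarrow> \<phi> t = 0" "\<And>t. b \<le> t \<Longrightarrow> \<phi> t = 0"
    "\<And>t. t \<le> 0 \<Longrightarrow> deriv \<phi> t = 0" "\<And>t. b \<le> t \<Longrightarrow> deriv \<phi> t = 0"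
proof -
  obtain a b where 1: "0 < a" "a < b" "\<And>t. t \<le> a \<Longrightarrow> \<phi> t = 0" "\<And>t. b \<le> t \<Longrightarrow> \<phi> t = 0"
    using test_function_supp assms(1) by blast
  obtain a' b' where 2: "0 < a'" "a' < b'" "\<And>t. t \<le> a' \<Longrightarrow> deriv \<phi> t = 0" "\<And>t. b' \<le> t \<Longrightarrow> deriv \<phi> t = 0"
    using test_function_supp test_function_deriv assms(1) by blast
  show ?thesis by (rule that[of "max b b'"]) (use 1 2 in simp_all)
qed

lemma L1loc_test:
  assumes "L1loc f" "test_function \<phi>"
  shows "set_integrable lebesgue {0..} (\<lambda>t. f t * \<phi> t)"
proof -
  obtain b where "0 < b" "\<And>t. b \<le> t \<Longrightarrow> \<phi> t = 0" using test_function_supp_deriv[OF assms(2)] by metis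
  then show ?thesis using assms test_function_continuous by (intro L1loc_times_continuous[of _ _ b]) auto
qed

lemma L1loc_continuous:
  assumes "continuous_on {0..} f" shows "L1loc f"
  unfolding L1loc_def
proof (intro allI impI)
  fix T :: real assume "0 \<le> T"
  have "continuous_on {0..T} f" by (rule continuous_on_subset[OF assms]) auto
  then have "set_integrable lborel {0..T} f" by (rule borel_integrable_atLeastAtMost')
  then show "set_integrable lebesgue {0..T} f"
    unfolding set_integrable_def by (auto intro: integrable_completion[THEN iffD2])
qed

lemma L1loc_add: "L1loc f \<Longrightarrow> L1loc g \<Longrightarrow> L1loc (\<lambda>t. f t + g t)"
  unfolding L1loc_def by (auto intro: set_integral_add)

lemma L1loc_cmult: "L1loc f \<Longrightarrow> L1loc (\<lambda>t. c * f t)"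
  unfolding L1loc_def by auto

lemma continuous_on_integral_L1loc:
  assumes g: "L1loc g" shows "continuous_on {0..} (\<lambda>t. integral {0..t} g)"
proof -
  have *: "continuous_on {0..T} (\<lambda>t. integral {0..t} g)" for T
  proof (cases "0 \<le> T")
    case True
    then have "g integrable_on {0..T}"
      using g set_lebesgue_integral_eq_integral(1) unfolding L1loc_def by blast
    then show ?thesis by (rule indefinite_integral_continuous_1)
  qed simp
  show ?thesis unfolding continuous_on_eq_continuous_within
  proof
    fix t :: real assume t: "t \<in> {0..}"
    have "continuous (at t within {0..t + 1}) (\<lambda>t. integral {0..t} g)"
      using *[of "t + 1"] t unfolding continuous_on_eq_continuous_within by simp
    moreover have "at t within {0..t + 1} = at t within {0..}"
      by (rule at_within_nhd[of _ "{..< t + 1}"]) (use t in auto)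
    ultimately show "continuous (at t within {0..}) (\<lambda>t. integral {0..t} g)" by simp
  qed
qed

text \<open>
  Exchange the order of integration over the triangle \<open>0 \<le> s \<le> t \<le> b\<close>, where \<open>b\<close> bounds the support
  of the test function \<open>\<phi>\<close>: the integral of \<open>\<phi>'\<close> over \<open>[s, b]\<close> is \<open>-\<phi>(s)\<close>.
\<close>

lemma weak_derivative_integral:
  assumes g: "L1loc g" shows "weak_derivative (\<lambda>t. integral {0..t} g) g"
  unfolding weak_derivative_def
proof (intro allI impI)
  fix \<phi> assume t: "test_function \<phi>"
  obtain b where b: "0 < b" "\<And>t. t \<le> 0 \<Longrightarrow> \<phi> t = 0" "\<And>t. b \<le> t \<Longrightarrow> \<phi> t = 0"
    "\<And>t. t \<le> 0 \<Longrightarrow> deriv \<phi> t = 0" "\<And>t. b \<le> t \<Longrightarrow> deriv \<phi> t = 0"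
    using test_function_supp_deriv[OF t] by metis
  let ?d = "deriv \<phi>"
  have cd: "continuous_on UNIV ?d" and cp: "continuous_on UNIV \<phi>"
    using t test_function_deriv test_function_continuous by auto
  have [measurable]: "?d \<in> borel_measurable borel" "\<phi> \<in> borel_measurable borel"
    using cd cp by (auto intro: borel_measurable_continuous_onI)
  have gi: "integrable lebesgue (\<lambda>s. indicator {0..b} s * g s)"
    using g b(1) unfolding L1loc_def set_integrable_def by simp
  \<comment> \<open>Fubini lives on \<open>lborel\<close>, hence the Borel version \<open>g0\<close> of \<open>g\<close> on \<open>[0, b]\<close>.\<close>
  from completion_ex_borel_measurable_real[OF borel_measurable_integrable[OF gi]]
  obtain g0 where g0[measurable]: "g0 \<in> borel_measurable borel"
    and ae: "AE s in lborel. indicator {0..b} s * g s = g0 s" by auto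
  have ae': "AE s in lebesgue. indicator {0..b} s * g s = g0 s" using ae by (rule AE_completion)
  have m0: "g0 \<in> borel_measurable lebesgue" by (rule measurable_completion) simp
  have "integrable lebesgue g0"
    by (rule integrable_cong_AE_imp[OF gi m0]) (use ae' in \<open>auto elim: eventually_mono\<close>)
  then have g0i: "integrable lborel g0" by (simp add: integrable_completion)
  define K where "K s t = (if 0 \<le> s \<and> s \<le> t \<and> t \<le> b then ?d t * g0 s else 0)" for s t
  have Km: "(\<lambda>(s, t). K s t) \<in> borel_measurable (lborel \<Otimes>\<^sub>M lborel)"
    unfolding K_def by measurable
  obtain C where C: "\<And>t. t \<in> {0..b} \<Longrightarrow> \<bar>?d t\<bar> \<le> C"
    using continuous_bounded_Icc[OF cd] by blast
  have Ki: "integrable (lborel \<Otimes>\<^sub>M lborel) (\<lambda>(s, t). K s t)"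
  proof (rule Bochner_Integration.integrable_bound[OF _ Km])
    show "integrable (lborel \<Otimes>\<^sub>M lborel) (\<lambda>(s, t). g0 s * (\<bar>C\<bar> * indicator {0..b} t))"
    proof (rule lborel_pair.Fubini_integrable)
      have "integrable lborel (indicator {0..b} :: real \<Rightarrow> real)"
        using b(1) by (intro integrable_real_indicator) auto
      then show "AE s in lborel. integrable lborel (\<lambda>t. case (s, t) of (s, t) \<Rightarrow> g0 s * (\<bar>C\<bar> * indicator {0..b} t))"
        by simp
      have "(\<lambda>s. LINT t|lborel. norm (case (s, t) of (s, t) \<Rightarrow> g0 s * (\<bar>C\<bar> * indicator {0..b} t)))
          = (\<lambda>s. \<bar>g0 s\<bar> * (\<bar>C\<bar> * b))"
        using b(1) by (auto simp: abs_mult)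
      then show "integrable lborel (\<lambda>s. LINT t|lborel. norm (case (s, t) of (s, t) \<Rightarrow> g0 s * (\<bar>C\<bar> * indicator {0..b} t)))"
        using g0i by simp
    qed measurable
    show "AE p in lborel \<Otimes>\<^sub>M lborel. norm (case p of (s, t) \<Rightarrow> K s t)
        \<le> norm (case p of (s, t) \<Rightarrow> g0 s * (\<bar>C\<bar> * indicator {0..b} t))"
    proof (rule AE_I2)
      fix p :: "real \<times> real"
      obtain s t where p: "p = (s, t)" by force
      show "norm (case p of (s, t) \<Rightarrow> K s t) \<le> norm (case p of (s, t) \<Rightarrow> g0 s * (\<bar>C\<bar> * indicator {0..b} t))"
      proof (cases "0 \<le> s \<and> s \<le> t \<and> t \<le> b")
        case True
        then have "\<bar>?d t\<bar> * \<bar>g0 s\<bar> \<le> \<bar>C\<bar> * \<bar>g0 s\<bar>"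
          using C[of t] by (intro mult_right_mono) auto
        with True show ?thesis by (simp add: p K_def abs_mult mult.commute)
      qed (auto simp: p K_def)
    qed
  qed
  have inner1: "(LINT s|lborel. K s t) = indicator {0..} t *\<^sub>R (integral {0..t} g * ?d t)" for t
  proof (cases "0 \<le> t \<and> t \<le> b")
    case True
    have "(LINT s|lborel. K s t) = (LINT s|lborel. ?d t * (indicator {0..t} s * g0 s))"
      by (rule Bochner_Integration.integral_cong) (use True in \<open>auto simp: K_def indicator_def\<close>)
    also have "\<dots> = ?d t * (LINT s|lborel. indicator {0..t} s * g0 s)" by simp
    also have "(LINT s|lborel. indicator {0..t} s * g0 s) = (LINT s|lebesgue. indicator {0..t} s * g0 s)"
      by (rule integral_completion[symmetric]) measurable
    also have "\<dots> = (LINT s|lebesgue. indicator {0..t} s *\<^sub>R g s)"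
    proof (rule integral_cong_AE)
      show "(\<lambda>s. indicator {0..t} s * g0 s) \<in> borel_measurable lebesgue"
        by (rule measurable_completion) measurable
      show "(\<lambda>s. indicator {0..t} s *\<^sub>R g s) \<in> borel_measurable lebesgue"
        using g True unfolding L1loc_def set_integrable_def
        by (intro borel_measurable_integrable) auto
      show "AE s in lebesgue. indicator {0..t} s * g0 s = indicator {0..t} s *\<^sub>R g s"
        using ae' by eventually_elim (use True in \<open>auto simp: indicator_def\<close>)
    qed
    also have "\<dots> = integral {0..t} g"
      using g True set_lebesgue_integral_eq_integral(2)[of "{0..t}" g]
      unfolding L1loc_def set_lebesgue_integral_def by simp
    finally show ?thesis using True by (simp add: mult.commute)
  next
    case False
    then have "K s t = 0" for s by (auto simp: K_def)
    with False b(5)[of t] show ?thesis by (auto simp: indicator_def)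
  qed
  have inner2: "(LINT t|lborel. K s t) = - (g0 s * \<phi> s)" for s
  proof (cases "0 \<le> s \<and> s \<le> b")
    case True
    have "(LINT t|lborel. K s t) = (LINT t|lborel. g0 s * (?d t * indicator {s..b} t))"
      by (rule Bochner_Integration.integral_cong) (use True in \<open>auto simp: K_def indicator_def\<close>)
    also have "\<dots> = g0 s * (LINT t|lborel. ?d t * indicator {s..b} t)" by simp
    also have "(LINT t|lborel. ?d t * indicator {s..b} t) = \<phi> b - \<phi> s"
      using True cd test_function_has_deriv[OF t]
      by (intro integral_FTC_Icc_real) (auto simp: continuous_on_eq_continuous_at)
    finally show ?thesis using b(3)[of b] by simp
  next
    case False
    then have "K s t = 0" for t by (auto simp: K_def)
    with False b(2,3)[of s] show ?thesis by auto
  qed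
  have "(LINT t:{0..}|lebesgue. integral {0..t} g * ?d t) = (LINT t|lebesgue. LINT s|lborel. K s t)"
    unfolding set_lebesgue_integral_def inner1 ..
  also have "\<dots> = (LINT t|lborel. LINT s|lborel. K s t)"
  proof (rule integral_completion)
    show "(\<lambda>t. LINT s|lborel. K s t) \<in> borel_measurable lborel"
      unfolding K_def by measurable
  qed
  also have "\<dots> = (LINT s|lborel. LINT t|lborel. K s t)"
    using lborel_pair.Fubini_integral[OF Ki] .
  also have "\<dots> = - (LINT s|lborel. g0 s * \<phi> s)" unfolding inner2 by simp
  also have "(LINT s|lborel. g0 s * \<phi> s) = (LINT s|lebesgue. g0 s * \<phi> s)"
    by (rule integral_completion[symmetric]) measurable
  also have "\<dots> = (LINT s|lebesgue. indicator {0..} s *\<^sub>R (g s * \<phi> s))"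
  proof (rule integral_cong_AE)
    show "(\<lambda>s. g0 s * \<phi> s) \<in> borel_measurable lebesgue" by (rule measurable_completion) measurable
    show "(\<lambda>s. indicator {0..} s *\<^sub>R (g s * \<phi> s)) \<in> borel_measurable lebesgue"
      using L1loc_test[OF g t] unfolding set_integrable_def by (rule borel_measurable_integrable)
    show "AE s in lebesgue. g0 s * \<phi> s = indicator {0..} s *\<^sub>R (g s * \<phi> s)"
      using ae'
    proof eventually_elim
      case (elim s)
      then show ?case using b(2,3)[of s] by (cases "0 \<le> s"; cases "s \<le> b") (auto simp: indicator_def)
    qed
  qed
  finally show "(LINT t:{0..}|lebesgue. integral {0..t} g * ?d t) = - (LINT t:{0..}|lebesgue. g t * \<phi> t)"
    unfolding set_lebesgue_integral_def .
qed

text \<open>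
  The positive and the negative part of \<open>h\<close> are densities of finite measures that agree on all
  half-lines \<open>(x, \<infinity>)\<close>; these determine the measures, and hence the densities up to null sets.
\<close>

lemma AE_0_if_interval_integrals_0:
  fixes h :: "real \<Rightarrow> real"
  assumes h: "integrable lebesgue h" and 0: "\<And>x. (LINT t:{x<..}|lebesgue. h t) = 0"
  shows "AE t in lebesgue. h t = 0"
proof -
  from completion_ex_borel_measurable_real[OF borel_measurable_integrable[OF h]]
  obtain g where g[measurable]: "g \<in> borel_measurable borel"
    and ae: "AE s in lborel. h s = g s" by auto
  have ae': "AE s in lebesgue. h s = g s" using ae by (rule AE_completion)
  have m0: "g \<in> borel_measurable lebesgue" by (rule measurable_completion) simp
  have "integrable lebesgue g" by (rule integrable_cong_AE_imp[OF h m0]) (use ae' in \<open>auto elim: eventually_mono\<close>)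
  then have gi: "integrable lborel g" by (simp add: integrable_completion)
  have gx: "integrable lborel (\<lambda>t. g t * indicator {x<..} t)" for x
    using gi by (intro integrable_real_mult_indicator) (simp_all add: borel_open)
  have g0: "(LINT t|lborel. g t * indicator {x<..} t) = 0" for x
  proof -
    have "(LINT t|lborel. g t * indicator {x<..} t) = (LINT t|lebesgue. g t * indicator {x<..} t)"
      by (rule integral_completion[symmetric]) measurable
    also have "\<dots> = (LINT t|lebesgue. indicator {x<..} t *\<^sub>R h t)"
    proof (rule integral_cong_AE)
      show "(\<lambda>t. g t * indicator {x<..} t) \<in> borel_measurable lebesgue"
        by (rule measurable_completion) measurable
      show "(\<lambda>t. indicator {x<..} t *\<^sub>R h t) \<in> borel_measurable lebesgue"
        using borel_measurable_integrable[OF h]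
        by (intro borel_measurable_scaleR borel_measurable_lebesgue_indicator) (simp_all add: borel_open)
      show "AE t in lebesgue. g t * indicator {x<..} t = indicator {x<..} t *\<^sub>R h t"
        using ae' by eventually_elim simp
    qed
    finally show ?thesis using 0[of x] unfolding set_lebesgue_integral_def by simp
  qed
  have em: "emeasure (density lborel (\<lambda>t. ennreal (f t))) {x<..} = (\<integral>\<^sup>+t. ennreal (f t * indicator {x<..} t) \<partial>lborel)"
    if [measurable]: "f \<in> borel_measurable borel" for f :: "real \<Rightarrow> real" and x
    by (subst emeasure_density) (auto intro!: nn_integral_cong simp: indicator_def)
  have pm: "(\<integral>\<^sup>+t. ennreal (g t * indicator {x<..} t) \<partial>lborel) = (\<integral>\<^sup>+t. ennreal (- g t * indicator {x<..} t) \<partial>lborel)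
     \<and> (\<integral>\<^sup>+t. ennreal (g t * indicator {x<..} t) \<partial>lborel) < \<infinity>" for x
  proof -
    from gx[of x] obtain r q where "0 \<le> r" "0 \<le> q"
      "(\<integral>\<^sup>+t. ennreal (g t * indicator {x<..} t) \<partial>lborel) = ennreal r"
      "(\<integral>\<^sup>+t. ennreal (- (g t * indicator {x<..} t)) \<partial>lborel) = ennreal q"
      "(\<lambda>t. g t * indicator {x<..} t) \<in> borel_measurable lborel"
      "(LINT t|lborel. g t * indicator {x<..} t) = r - q" by (rule integrableE)
    then show ?thesis using g0[of x] by simp
  qed
  have "density lborel (\<lambda>t. ennreal (g t)) = density lborel (\<lambda>t. ennreal (- g t))"
  proof (rule measure_eqI_lessThan)
    fix x
    have m: "(\<lambda>t. - g t) \<in> borel_measurable borel" by measurable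
    show "emeasure (density lborel (\<lambda>t. ennreal (g t))) {x<..} < \<infinity>"
      unfolding em[OF g] using pm[of x] by blast
    show "emeasure (density lborel (\<lambda>t. ennreal (g t))) {x<..} = emeasure (density lborel (\<lambda>t. ennreal (- g t))) {x<..}"
      unfolding em[OF g] em[OF m] using pm[of x] by blast
  qed simp_all
  then have "AE t in lborel. ennreal (g t) = ennreal (- g t)"
    by (intro sigma_finite_measure.density_unique[OF sigma_finite_lborel]) measurable
  then have "AE t in lborel. g t = 0"
  proof eventually_elim
    case (elim t)
    then show ?case by (cases "0 \<le> g t") (auto simp: ennreal_neg ennreal_eq_0_iff)
  qed
  then have "AE t in lebesgue. g t = 0" by (rule AE_completion)
  with ae' show ?thesis by eventually_elim simp
qed

text \<open>
  Bumps converge to indicator functions, so by dominated convergence all integrals of \<open>h\<close> over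
  intervals \<open>(a, b)\<close> with \<open>a > 0\<close> vanish. Exhausting \<open>(0, \<infinity>)\<close> by \<open>(1/N, N)\<close> reduces to the integrable
  case.
\<close>

lemma AE_0_if_test_integrals_0:
  assumes h: "L1loc h" and 0: "\<And>\<phi>. test_function \<phi> \<Longrightarrow> (LINT t:{0..}|lebesgue. h t * \<phi> t) = 0"
  shows "AE t in lebesgue. 0 \<le> t \<longrightarrow> h t = 0"
proof -
  have int0: "(LINT t:{a<..<b}|lebesgue. h t) = 0" if ab: "0 < a" "a < b" for a b
  proof -
    have hi: "integrable lebesgue (\<lambda>t. indicator {0..b} t *\<^sub>R h t)"
      using h ab unfolding L1loc_def set_integrable_def by simp
    have "(\<lambda>k. LINT t|lebesgue. indicator {0..} t *\<^sub>R (h t * bump a b k t)) \<longlonglongrightarrow>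
        (LINT t|lebesgue. indicator {a<..<b} t *\<^sub>R h t)"
    proof (rule integral_dominated_convergence)
      show "integrable lebesgue (\<lambda>t. norm (indicator {0..b} t *\<^sub>R h t))" using hi by (rule integrable_norm)
      show "(\<lambda>t. indicator {a<..<b} t *\<^sub>R h t) \<in> borel_measurable lebesgue"
      proof -
        have "(\<lambda>t. indicator {a<..<b} t * (indicator {0..b} t *\<^sub>R h t)) \<in> borel_measurable lebesgue"
          using borel_measurable_integrable[OF hi]
          by (intro borel_measurable_times borel_measurable_lebesgue_indicator) (simp_all add: borel_open)
        moreover have "(\<lambda>t. indicator {a<..<b} t * (indicator {0..b} t *\<^sub>R h t)) = (\<lambda>t. indicator {a<..<b} t *\<^sub>R h t)"
          using ab by (auto simp: indicator_def fun_eq_iff)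
        ultimately show ?thesis by (simp only:)
      qed
      show "(\<lambda>t. indicator {0..} t *\<^sub>R (h t * bump a b k t)) \<in> borel_measurable lebesgue" for k
        using L1loc_test[OF h test_function_bump[OF ab(1)]] unfolding set_integrable_def
        by (rule borel_measurable_integrable)
      show "AE t in lebesgue. (\<lambda>k. indicator {0..} t *\<^sub>R (h t * bump a b k t)) \<longlonglongrightarrow> indicator {a<..<b} t *\<^sub>R h t"
      proof (rule AE_I2)
        fix t
        have "(\<lambda>k. indicator {0..} t *\<^sub>R (h t * bump a b k t)) \<longlonglongrightarrow> indicator {0..} t *\<^sub>R (h t * indicator {a<..<b} t)"
          by (intro tendsto_intros bump_tendsto_indicator)
        moreover have "indicator {0..} t *\<^sub>R (h t * indicator {a<..<b} t) = indicator {a<..<b} t *\<^sub>R h t"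
          using ab by (auto simp: indicator_def)
        ultimately show "(\<lambda>k. indicator {0..} t *\<^sub>R (h t * bump a b k t)) \<longlonglongrightarrow> indicator {a<..<b} t *\<^sub>R h t"
          by (simp only:)
      qed
      show "AE t in lebesgue. norm (indicator {0..} t *\<^sub>R (h t * bump a b k t)) \<le> norm (indicator {0..b} t *\<^sub>R h t)" for k
      proof (rule AE_I2)
        fix t
        show "norm (indicator {0..} t *\<^sub>R (h t * bump a b k t)) \<le> norm (indicator {0..b} t *\<^sub>R h t)"
        proof (cases "t \<in> {a<..<b}")
          case True
          have "\<bar>h t\<bar> * \<bar>bump a b k t\<bar> \<le> \<bar>h t\<bar> * 1"
            using bump_bounds[of a b k t] by (intro mult_left_mono) auto
          then show ?thesis using True ab by (simp add: abs_mult)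
        qed (simp add: bump_eq_0)
      qed
    qed
    moreover have "(LINT t|lebesgue. indicator {0..} t *\<^sub>R (h t * bump a b k t)) = 0" for k
      using 0[OF test_function_bump[OF ab(1)]] unfolding set_lebesgue_integral_def .
    ultimately have "(\<lambda>k. 0) \<longlonglongrightarrow> (LINT t|lebesgue. indicator {a<..<b} t *\<^sub>R h t)" by simp
    then show ?thesis unfolding set_lebesgue_integral_def by (simp add: LIMSEQ_const_iff)
  qed
  have "AE t in lebesgue. indicator {1 / real (Suc N)<..<real (Suc N)} t *\<^sub>R h t = 0" for N
  proof (rule AE_0_if_interval_integrals_0)
    let ?I = "{1 / real (Suc N)<..<real (Suc N)}"
    have "set_integrable lebesgue {0..real (Suc N)} h" using h unfolding L1loc_def by simp
    moreover have "?I \<subseteq> {0..real (Suc N)}"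
    proof
      fix t assume "t \<in> ?I"
      moreover have "0 < 1 / real (Suc N)" by simp
      ultimately show "t \<in> {0..real (Suc N)}"
        unfolding greaterThanLessThan_iff atLeastAtMost_iff by linarith
    qed
    moreover have "?I \<in> sets lebesgue" by simp
    ultimately have "set_integrable lebesgue ?I h" using set_integrable_subset by blast
    then show "integrable lebesgue (\<lambda>t. indicator ?I t *\<^sub>R h t)" unfolding set_integrable_def .
    fix x :: real
    let ?y = "max x (1 / real (Suc N))"
    have "(LINT t:{x<..}|lebesgue. indicator ?I t *\<^sub>R h t) = (LINT t:{?y<..<real (Suc N)}|lebesgue. h t)"
      unfolding set_lebesgue_integral_def
      by (rule Bochner_Integration.integral_cong) (auto simp: indicator_def)
    also have "\<dots> = 0"
    proof (cases "?y < real (Suc N)")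
      case True
      have "0 < ?y" by (simp add: less_max_iff_disj)
      then show ?thesis using True by (rule int0)
    next
      case False
      then have "{?y<..<real (Suc N)} = {}" by (simp only: greaterThanLessThan_empty_iff not_less)
      then show ?thesis by (simp only: set_lebesgue_integral_def) simp
    qed
    finally show "(LINT t:{x<..}|lebesgue. indicator ?I t *\<^sub>R h t) = 0" .
  qed
  then have all: "AE t in lebesgue. \<forall>N. indicator {1 / real (Suc N)<..<real (Suc N)} t *\<^sub>R h t = 0"
    unfolding AE_all_countable by blast
  have ne: "AE t in lebesgue. t \<noteq> (0::real)" by (intro AE_completion AE_lborel_singleton)
  from all ne show ?thesis
  proof eventually_elim
    case (elim t)
    show ?case
    proof
      assume "0 \<le> t"
      with elim have t: "0 < t" by simp
      obtain N where N: "max t (1 / t) < real N" using reals_Archimedean2 by blast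
      then have "t \<in> {1 / real (Suc N)<..<real (Suc N)}" using t by (auto simp: field_simps)
      with elim(1) show "h t = 0" by (metis indicator_simps(1) scale_one)
    qed
  qed
qed

lemma integral_test_lebesgue:
  assumes "test_function \<psi>"
  shows "(LINT t:{0..}|lebesgue. \<psi> t) = (LINT t|lborel. \<psi> t)"
proof -
  obtain b where b: "\<And>t. t \<le> 0 \<Longrightarrow> \<psi> t = 0" using test_function_supp_deriv[OF assms] by metis
  have "(\<lambda>t. indicator {0..} t *\<^sub>R \<psi> t) = \<psi>"
  proof
    fix t show "indicator {0..} t *\<^sub>R \<psi> t = \<psi> t" using b[of t] by (auto simp: indicator_def)
  qed
  moreover have "(LINT t|lebesgue. \<psi> t) = (LINT t|lborel. \<psi> t)"
    using test_function_continuous[OF assms]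
    by (intro integral_completion) (simp add: borel_measurable_continuous_onI)
  ultimately show ?thesis unfolding set_lebesgue_integral_def by simp
qed

text \<open>
  Otherwise the bump would have a compactly supported primitive; this primitive is nondecreasing,
  hence zero, and so would be the bump.
\<close>

lemma integral_bump_nonzero: "(LINT t|lborel. bump 1 2 0 t) \<noteq> 0"
proof
  assume "(LINT t|lborel. bump 1 2 0 t) = 0"
  moreover have tf: "test_function (bump 1 2 0)" by (rule test_function_bump) simp
  ultimately obtain \<phi> where \<phi>: "test_function \<phi>" "deriv \<phi> = bump 1 2 0"
    using test_function_primitive by blast
  obtain b where b: "0 < b" "\<And>t. t \<le> 0 \<Longrightarrow> \<phi> t = 0" "\<And>t. b \<le> t \<Longrightarrow> \<phi> t = 0"
    using test_function_supp_deriv[OF \<phi>(1)] by metis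
  have mono: "\<phi> s \<le> \<phi> t" if "s \<le> t" for s t
    using DERIV_nonneg_imp_nondecreasing[OF that, of \<phi>] test_function_has_deriv[OF \<phi>(1)] \<phi>(2)
      bump_bounds(1) by metis
  have "\<phi> t = 0" for t
  proof (rule antisym)
    have "\<phi> (max t b) = 0" by (rule b(3)) simp
    with mono[of t "max t b"] show "\<phi> t \<le> 0" by simp
    have "\<phi> (min t 0) = 0" by (rule b(2)) simp
    with mono[of "min t 0" t] show "0 \<le> \<phi> t" by simp
  qed
  then have "\<phi> = (\<lambda>t. 0)" by auto
  then have "deriv \<phi> (3 / 2) = 0" by simp
  moreover have "0 < bump 1 2 0 (3 / 2)" by (rule bump_pos) simp
  ultimately show False using \<phi>(2) by simp
qed

text \<open>
  Every test function \<open>\<psi>\<close> becomes the derivative of a test function after subtracting the multiple of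
  one fixed bump that has the same mean. The hypothesis then says that the integral of \<open>h \<psi>\<close> is
  proportional to the mean of \<open>\<psi>\<close>, and \<open>c\<close> is the factor of proportionality.
\<close>

lemma du_Bois_Reymond:
  assumes h: "L1loc h"
    and 0: "\<And>\<phi>. test_function \<phi> \<Longrightarrow> (LINT t:{0..}|lebesgue. h t * deriv \<phi> t) = 0"
  obtains c where "AE t in lebesgue. 0 \<le> t \<longrightarrow> h t = c"
proof -
  let ?b = "bump 1 2 0"
  have tb: "test_function ?b" by (rule test_function_bump) simp
  define I where "I = (LINT t|lborel. ?b t)"
  have I: "I \<noteq> 0" unfolding I_def by (rule integral_bump_nonzero)
  define c where "c = (LINT t:{0..}|lebesgue. h t * ?b t) / I"
  have const: "L1loc (\<lambda>t. - c)" by (intro L1loc_continuous continuous_intros)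
  have one: "L1loc (\<lambda>t. 1)" by (intro L1loc_continuous continuous_intros)
  have "AE t in lebesgue. 0 \<le> t \<longrightarrow> h t + - c = 0"
  proof (rule AE_0_if_test_integrals_0)
    show "L1loc (\<lambda>t. h t + - c)" using h const by (rule L1loc_add)
    fix \<psi> assume t: "test_function \<psi>"
    define J where "J = (LINT t|lborel. \<psi> t)"
    have lbi: "integrable lborel \<phi>" if "test_function \<phi>" for \<phi>
    proof -
      have "set_integrable lebesgue {0..} \<phi>" using L1loc_test[OF one that] by simp
      moreover have "(\<lambda>t. indicator {0..} t *\<^sub>R \<phi> t) = \<phi>"
      proof
        obtain b where b: "\<And>t. t \<le> 0 \<Longrightarrow> \<phi> t = 0" 
          using test_function_supp_deriv[OF \<open>test_function \<phi>\<close>] by metis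
        fix t show "indicator {0..} t *\<^sub>R \<phi> t = \<phi> t" using b[of t] by (auto simp: indicator_def)
      qed
      ultimately show ?thesis unfolding set_integrable_def
        using test_function_continuous[OF that]
        by (simp add: integrable_completion borel_measurable_continuous_onI)
    qed
    define k where "k = - J / I"
    let ?\<chi> = "\<lambda>t. \<psi> t + k * ?b t"
    have t\<chi>: "test_function ?\<chi>" using t tb by (rule test_function_linear)
    have "(LINT t|lborel. ?\<chi> t) = J + k * I"
      unfolding J_def I_def using lbi[OF t] lbi[OF tb] by simp
    then have "(LINT t|lborel. ?\<chi> t) = 0" using I by (simp add: k_def)
    then obtain \<phi> where \<phi>: "test_function \<phi>" "deriv \<phi> = ?\<chi>"
      using test_function_primitive[OF t\<chi>] by blast
    have i1: "set_integrable lebesgue {0..} (\<lambda>t. h t * \<psi> t)" by (rule L1loc_test[OF h t])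
    have i2: "set_integrable lebesgue {0..} (\<lambda>t. h t * ?b t)" by (rule L1loc_test[OF h tb])
    have i3: "set_integrable lebesgue {0..} (\<lambda>t. \<psi> t)" using L1loc_test[OF one t] by simp
    have "0 = (LINT t:{0..}|lebesgue. h t * ?\<chi> t)" using 0[OF \<phi>(1)] \<phi>(2) by simp
    also have "\<dots> = (LINT t:{0..}|lebesgue. h t * \<psi> t + k * (h t * ?b t))"
      by (simp add: algebra_simps)
    also have "\<dots> = (LINT t:{0..}|lebesgue. h t * \<psi> t) + k * (LINT t:{0..}|lebesgue. h t * ?b t)"
      using i1 i2 by (subst set_integral_add(2)) auto
    also have "\<dots> = (LINT t:{0..}|lebesgue. h t * \<psi> t) + - c * J"
      by (simp add: c_def k_def)
    also have "J = (LINT t:{0..}|lebesgue. \<psi> t)" unfolding J_def using integral_test_lebesgue[OF t] by simp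
    also have "(LINT t:{0..}|lebesgue. h t * \<psi> t) + - c * (LINT t:{0..}|lebesgue. \<psi> t)
        = (LINT t:{0..}|lebesgue. h t * \<psi> t + - c * \<psi> t)"
    proof -
      have i4: "set_integrable lebesgue {0..} (\<lambda>t. - c * \<psi> t)"
        using i3 by (rule set_integrable_mult_right)
      show ?thesis unfolding set_integral_add(2)[OF i1 i4] set_integral_mult_right ..
    qed
    also have "\<dots> = (LINT t:{0..}|lebesgue. (h t + - c) * \<psi> t)" by (simp add: algebra_simps)
    finally show "(LINT t:{0..}|lebesgue. (h t + - c) * \<psi> t) = 0" by simp
  qed
  then show ?thesis by (intro that[of c]) simp
qed

lemma weak_derivative_imp_AE_integral:
  assumes f: "L1loc f" and g: "L1loc g" and w: "weak_derivative f g"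
  obtains c where "AE t in lebesgue. 0 \<le> t \<longrightarrow> f t = c + integral {0..t} g"
proof -
  let ?G = "\<lambda>t. integral {0..t} g"
  have G: "L1loc ?G" using continuous_on_integral_L1loc[OF g] by (rule L1loc_continuous)
  have l: "L1loc (\<lambda>t. f t + (- 1) * ?G t)" using f G by (intro L1loc_add L1loc_cmult)
  obtain c where "AE t in lebesgue. 0 \<le> t \<longrightarrow> f t + (- 1) * ?G t = c"
  proof (rule du_Bois_Reymond[OF l])
    fix \<phi> assume t: "test_function \<phi>"
    have td: "test_function (deriv \<phi>)" using t by (rule test_function_deriv)
    have "(LINT t:{0..}|lebesgue. (f t + (- 1) * ?G t) * deriv \<phi> t)
      = (LINT t:{0..}|lebesgue. f t * deriv \<phi> t - ?G t * deriv \<phi> t)" by (simp add: algebra_simps)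
    also have "\<dots> = (LINT t:{0..}|lebesgue. f t * deriv \<phi> t) - (LINT t:{0..}|lebesgue. ?G t * deriv \<phi> t)"
      by (rule set_integral_diff(2)[OF L1loc_test[OF f td] L1loc_test[OF G td]])
    also have "\<dots> = 0"
      using w weak_derivative_integral[OF g] t unfolding weak_derivative_def by simp
    finally show "(LINT t:{0..}|lebesgue. (f t + (- 1) * ?G t) * deriv \<phi> t) = 0" .
  qed
  then show ?thesis by (intro that[of c]) (auto elim!: eventually_mono)
qed

lemma continuous_AE_eq_imp_eq:
  fixes f g :: "real \<Rightarrow> real"
  assumes f: "continuous_on {0..} f" and g: "continuous_on {0..} g"
    and ae: "AE t in lebesgue. 0 \<le> t \<longrightarrow> f t = g t" and t: "0 \<le> t"
  shows "f t = g t"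
proof -
  let ?D = "\<lambda>t. f t - g t"
  have D: "continuous_on {0..} ?D" using f g by (intro continuous_intros)
  have pos: "?D s = 0" if "s \<in> {0<..}" for s
  proof (rule ccontr)
    assume "?D s \<noteq> 0"
    let ?U = "?D -` (- {0}) \<inter> {0<..}"
    have "continuous_on {0<..} ?D" by (rule continuous_on_subset[OF D]) auto
    then have "open ?U"
      by (intro continuous_open_preimage[of "{0<..}" ?D "- {0}", unfolded Int_commute[of "{0<..}"]]) auto
    moreover have "AE x \<in> ?U in lebesgue. x \<in> {}"
      using ae by eventually_elim auto
    ultimately have "s \<in> {}"
      by (rule mem_closed_if_AE_lebesgue_open[OF _ closed_empty]) (use that \<open>?D s \<noteq> 0\<close> in auto)
    then show False by simp
  qed
  have "?D t = 0"
    by (rule continuous_constant_on_closure[of "{0<..}"]) (use D pos t in auto)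
  then show ?thesis by simp
qed

text \<open>
  The choice in \<^const>\<open>continuous_rep\<close> is immaterial on the half-line, since continuous functions that
  agree almost everywhere on \<open>[0, \<infinity>)\<close> agree there everywhere.
\<close>

lemma continuous_rep_unique:
  assumes g: "continuous_on {0..} g" and ae: "AE t in lebesgue. 0 \<le> t \<longrightarrow> g t = f t" and t: "0 \<le> t"
  shows "continuous_rep f t = g t"
proof -
  let ?P = "\<lambda>g. continuous_on {0..} g \<and> (AE t in lebesgue. 0 \<le> t \<longrightarrow> g t = f t)"
  have P: "?P (continuous_rep f)" unfolding continuous_rep_def 
    by (rule someI_ex[of ?P], rule exI[of _ g]) (use g ae in blast)
  show ?thesis
  proof (rule continuous_AE_eq_imp_eq[OF _ g _ t])
    show "continuous_on {0..} (continuous_rep f)" using P by blast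
    from P ae show "AE t in lebesgue. 0 \<le> t \<longrightarrow> continuous_rep f t = g t"
      by (auto elim!: eventually_elim2)
  qed
qed

text \<open>
  By the lemma of du Bois-Reymond, a function with weak derivative \<open>g\<close> differs from the continuous
  function \<open>t \<mapsto> \<integral>\<^sub>0\<^sup>t g\<close> by a constant almost everywhere.
\<close>

lemma W11loc_continuous_rep:
  assumes "W11loc f"
  obtains g where "continuous_on {0..} g" "AE t in lebesgue. 0 \<le> t \<longrightarrow> g t = f t"
proof -
  obtain g where g: "L1loc f" "L1loc g" "weak_derivative f g" using assms unfolding W11loc_def by blast
  obtain c where "AE t in lebesgue. 0 \<le> t \<longrightarrow> f t = c + integral {0..t} g"
    using weak_derivative_imp_AE_integral[OF g] by blast
  then show ?thesis
    by (intro that[of "\<lambda>t. c + integral {0..t} g"] continuous_intros continuous_on_integral_L1loc[OF g(2)])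
       (auto elim!: eventually_mono)
qed

section \<open>Time shifts and the decrease of the value function\<close>

lemma AE_lebesgue_shift:
  assumes "AE t in lebesgue. P (t :: real)" shows "AE t in lebesgue. P (t + d)"
proof -
  from assms obtain N where N: "{t \<in> space lebesgue. \<not> P t} \<subseteq> N" "N \<in> null_sets lebesgue"
    by (auto elim: AE_E simp: null_sets_def)
  have "negligible ((+) (- d) ` N)"
    using N(2) by (intro negligible_translation) (simp add: negligible_iff_null_sets)
  then have "(+) (- d) ` N \<in> null_sets lebesgue" by (simp add: negligible_iff_null_sets)
  then show ?thesis
  proof (rule AE_I')
    show "{t \<in> space lebesgue. \<not> P (t + d)} \<subseteq> (+) (- d) ` N"
    proof
      fix t assume "t \<in> {t \<in> space lebesgue. \<not> P (t + d)}"
      then have "t + d \<in> N" using N(1) by auto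
      then show "t \<in> (+) (- d) ` N" by (intro image_eqI[of _ _ "t + d"]) auto
    qed
  qed
qed

lemma L1loc_shift:
  assumes f: "L1loc f" and d: "0 \<le> d" shows "L1loc (\<lambda>t. f (t + d))"
  unfolding L1loc_def
proof (intro allI impI)
  fix T :: real assume T: "0 \<le> T"
  have "set_integrable lebesgue {0..T + d} f" using f T d unfolding L1loc_def by simp
  then have "set_integrable lebesgue {d..T + d} f"
    by (rule set_integrable_subset) (use d in auto)
  then have "integrable lebesgue (\<lambda>t. indicator {d..T + d} (d + 1 * t) *\<^sub>R f (d + 1 * t))"
    unfolding set_integrable_def
    using lebesgue_integrable_real_affine_iff[of 1 "\<lambda>t. indicator {d..T + d} t *\<^sub>R f t" d] by simp
  moreover have "(\<lambda>t. indicator {d..T + d} (d + 1 * t) *\<^sub>R f (d + 1 * t))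
      = (\<lambda>t. indicator {0..T} t *\<^sub>R f (t + d))"
    by (auto simp: indicator_def add.commute)
  ultimately show "set_integrable lebesgue {0..T} (\<lambda>t. f (t + d))"
    unfolding set_integrable_def by (simp only:)
qed

lemma weak_derivative_shift:
  assumes w: "weak_derivative f g" and d: "0 \<le> d"
  shows "weak_derivative (\<lambda>t. f (t + d)) (\<lambda>t. g (t + d))"
  unfolding weak_derivative_def
proof (intro allI impI)
  fix \<phi> assume t: "test_function \<phi>"
  let ?\<psi> = "\<lambda>t. \<phi> (t - d)"
  have t\<psi>: "test_function ?\<psi>" using t d by (rule test_function_shift)
  have d\<psi>: "deriv ?\<psi> s = deriv \<phi> (s - d)" for s
  proof (rule DERIV_imp_deriv)
    have "((\<lambda>t. t - d) has_real_derivative 1) (at s)" by (auto intro!: derivative_eq_intros)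
    from DERIV_chain2[OF test_function_has_deriv[OF t] this]
    show "(?\<psi> has_real_derivative deriv \<phi> (s - d)) (at s)" by simp
  qed
  have *: "(LINT t:{0..}|lebesgue. h (t + d) * \<chi> t) = (LINT t:{0..}|lebesgue. h t * \<chi> (t - d))"
    if tc: "test_function \<chi>" for h \<chi>
  proof -
    obtain b where b: "\<And>t. t \<le> 0 \<Longrightarrow> \<chi> t = 0" using test_function_supp_deriv[OF tc] by metis
    have "(\<lambda>t. indicator {0..} (d + 1 * t) *\<^sub>R (h (d + 1 * t) * \<chi> ((d + 1 * t) - d)))
        = (\<lambda>t. indicator {0..} t *\<^sub>R (h (t + d) * \<chi> t))"
    proof
      fix t show "indicator {0..} (d + 1 * t) *\<^sub>R (h (d + 1 * t) * \<chi> ((d + 1 * t) - d))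
          = indicator {0..} t *\<^sub>R (h (t + d) * \<chi> t)"
        using b[of t] d by (cases "0 \<le> t") (auto simp: indicator_def add.commute)
    qed
    then show ?thesis unfolding set_lebesgue_integral_def
      using lebesgue_integral_real_affine[of 1 "\<lambda>t. indicator {0..} t *\<^sub>R (h t * \<chi> (t - d))" d]
      by simp
  qed
  have "(LINT t:{0..}|lebesgue. f (t + d) * deriv \<phi> t) = (LINT t:{0..}|lebesgue. f t * deriv ?\<psi> t)"
    using *[OF test_function_deriv[OF t]] by (simp add: d\<psi>)
  also have "\<dots> = - (LINT t:{0..}|lebesgue. g t * ?\<psi> t)"
    using w t\<psi> unfolding weak_derivative_def by simp
  also have "(LINT t:{0..}|lebesgue. g t * ?\<psi> t) = (LINT t:{0..}|lebesgue. g (t + d) * \<phi> t)"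
    using *[OF t] by simp
  finally show "(LINT t:{0..}|lebesgue. f (t + d) * deriv \<phi> t) = - (LINT t:{0..}|lebesgue. g (t + d) * \<phi> t)" .
qed

lemma W11loc_shift: "W11loc f \<Longrightarrow> 0 \<le> d \<Longrightarrow> W11loc (\<lambda>t. f (t + d))"
  unfolding W11loc_def using L1loc_shift weak_derivative_shift by blast

lemma behaviour_shift:
  assumes xu: "(x, u) \<in> behaviour E A B" and d: "0 \<le> d"
  shows "(\<lambda>t. x (t + d), \<lambda>t. u (t + d)) \<in> behaviour E A B"
proof -
  from xu obtain z where z: "L1loc_vec (dim_row E) z" "weak_derivative_vec (dim_row E) (\<lambda>t. E *\<^sub>v x t) z"
    "AE t in lebesgue. 0 \<le> t \<longrightarrow> z t = A *\<^sub>v x t + B *\<^sub>v u t"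
    and xu': "L1loc_vec (dim_col E) x" "L1loc_vec (dim_col B) u" "W11loc_vec (dim_row E) (\<lambda>t. E *\<^sub>v x t)"
    unfolding behaviour_def by blast
  have L: "L1loc_vec k (\<lambda>t. f (t + d))" if "L1loc_vec k f" for k f
    using that d unfolding L1loc_vec_def by (auto intro: L1loc_shift)
  have W: "W11loc_vec k (\<lambda>t. f (t + d))" if "W11loc_vec k f" for k f
    using that d unfolding W11loc_vec_def by (auto intro: W11loc_shift)
  have "weak_derivative_vec (dim_row E) (\<lambda>t. E *\<^sub>v x (t + d)) (\<lambda>t. z (t + d))"
    using z(2) d weak_derivative_shift unfolding weak_derivative_vec_def by blast
  moreover have "AE t in lebesgue. 0 \<le> t \<longrightarrow> z (t + d) = A *\<^sub>v x (t + d) + B *\<^sub>v u (t + d)"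
    using AE_lebesgue_shift[OF z(3), of d] by eventually_elim (use d in auto)
  ultimately show ?thesis
    unfolding behaviour_def using L[OF z(1)] L[OF xu'(1)] L[OF xu'(2)] W[OF xu'(3)] by blast
qed

text \<open>
  At almost every time the function \<open>E x\<close> coincides with its continuous representative. From such a
  time on the shifted trajectory starts at the value \<open>E (x d)\<close> itself.
\<close>

lemma AE_initial_cond_shift:
  assumes xu: "(x, u) \<in> behaviour E A B"
  shows "AE d in lebesgue. 0 \<le> d \<longrightarrow> initial_cond E (\<lambda>t. x (t + d)) (x d)"
proof -
  let ?f = "\<lambda>i t. (E *\<^sub>v x t) $ i"
  have W: "W11loc (?f i)" if "i < dim_row E" for i
    using xu that unfolding behaviour_def W11loc_vec_def by blast
  have "AE d in lebesgue. i < dim_row E \<longrightarrow> 0 \<le> d \<longrightarrow> continuous_rep (\<lambda>t. ?f i (t + d)) 0 = ?f i d" for i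
  proof (cases "i < dim_row E")
    case True
    obtain g where g: "continuous_on {0..} g" "AE t in lebesgue. 0 \<le> t \<longrightarrow> g t = ?f i t"
      using W11loc_continuous_rep[OF W[OF True]] .
    from g(2) show ?thesis
    proof eventually_elim
      case (elim d)
      show ?case
      proof (intro impI)
        assume d: "0 \<le> d"
        have "continuous_rep (\<lambda>t. ?f i (t + d)) 0 = g (0 + d)"
        proof (rule continuous_rep_unique)
          show "continuous_on {0..} (\<lambda>t. g (t + d))"
            by (rule continuous_on_compose2[OF g(1)]) (use d in \<open>auto intro!: continuous_intros\<close>)
          show "AE t in lebesgue. 0 \<le> t \<longrightarrow> g (t + d) = ?f i (t + d)"
            using AE_lebesgue_shift[OF g(2), of d] by eventually_elim (use d in auto)
        qed simp
        with elim d show "continuous_rep (\<lambda>t. ?f i (t + d)) 0 = ?f i d" by simp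
      qed
    qed
  qed simp
  then have "AE d in lebesgue. \<forall>i. i < dim_row E \<longrightarrow> 0 \<le> d \<longrightarrow> continuous_rep (\<lambda>t. ?f i (t + d)) 0 = ?f i d"
    unfolding AE_all_countable by blast
  then show ?thesis
  proof eventually_elim
    case (elim d)
    then show ?case unfolding initial_cond_def eval_vec_def by (intro impI eq_vecI) auto
  qed
qed

lemma L1loc_measurable:
  assumes "L1loc f" shows "(\<lambda>t. indicator {0..} t * f t) \<in> borel_measurable lebesgue"
proof (rule borel_measurable_LIMSEQ_real)
  show "(\<lambda>t. indicator {0..real n} t * f t) \<in> borel_measurable lebesgue" for n
  proof -
    have "integrable lebesgue (\<lambda>t. indicator {0..real n} t *\<^sub>R f t)"
      using assms unfolding L1loc_def set_integrable_def by simp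
    then show ?thesis using borel_measurable_integrable by auto
  qed
  fix t :: real
  obtain N where N: "t \<le> real N" using real_arch_simple by blast
  have "\<forall>\<^sub>F n in sequentially. indicator {0..real n} t * f t = indicator {0..} t * f t"
    using eventually_ge_at_top[of N]
  proof eventually_elim
    case (elim n)
    then have "t \<le> real n" using N by linarith
    then show ?case by (auto simp: indicator_def)
  qed
  then show "(\<lambda>n. indicator {0..real n} t * f t) \<longlonglongrightarrow> indicator {0..} t * f t"
    by (rule tendsto_eventually)
qed

text \<open>
  The factor \<open>indicator {0..}\<close> is needed because nothing is known about trajectories at negative times.
\<close>

lemma stage_cost_measurable:
  assumes S: "S \<in> carrier_mat (n + m) (n + m)" and x: "L1loc_vec n x" and u: "L1loc_vec m u"
  shows "(\<lambda>t. indicator {0..} t * stage_cost S (x t) (u t)) \<in> borel_measurable lebesgue"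
proof -
  define W where "W i t = indicator {0..} t * (if i < n then x t $ i else u t $ (i - n))" for i t
  have W: "W i \<in> borel_measurable lebesgue" if "i < n + m" for i
    unfolding W_def using that x u unfolding L1loc_vec_def
    by (cases "i < n") (auto intro: L1loc_measurable)
  have "(\<lambda>t. \<Sum>i<n+m. W i t * (\<Sum>j<n+m. S $$ (i, j) * W j t)) \<in> borel_measurable lebesgue"
    by (intro borel_measurable_sum borel_measurable_times borel_measurable_const W) auto
  moreover have "(\<lambda>t. \<Sum>i<n+m. W i t * (\<Sum>j<n+m. S $$ (i, j) * W j t)) =
      (\<lambda>t. indicator {0..} t * stage_cost S (x t) (u t))"
  proof
    fix t :: real
    show "(\<Sum>i<n+m. W i t * (\<Sum>j<n+m. S $$ (i, j) * W j t)) = indicator {0..} t * stage_cost S (x t) (u t)"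
    proof (cases "0 \<le> t")
      case True
      then have c: "x t \<in> carrier_vec n" "u t \<in> carrier_vec m"
        using x u unfolding L1loc_vec_def by auto
      have w: "(x t @\<^sub>v u t) $ i = W i t" if "i < n + m" for i
        using c that True by (auto simp: W_def)
      have "stage_cost S (x t) (u t) = (\<Sum>i<n+m. (x t @\<^sub>v u t) $ i * (\<Sum>j<n+m. S $$ (i, j) * (x t @\<^sub>v u t) $ j))"
        using c S by (auto simp: stage_cost_def scalar_prod_def atLeast0LessThan intro!: sum.cong)
      also have "\<dots> = (\<Sum>i<n+m. W i t * (\<Sum>j<n+m. S $$ (i, j) * W j t))"
        by (intro sum.cong refl arg_cong2[of _ _ _ _ "(*)"]) (simp_all add: w)
      finally show ?thesis using True by simp
    qed (simp add: W_def)
  qed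
  ultimately show ?thesis by (simp only:)
qed

text \<open>
  Additivity of the integral over \<open>[0, d]\<close> and \<open>[d, \<infinity>)\<close>. Positive and negative parts are split separately
  and may be infinite; as \<open>\<infinity> - \<infinity> = \<infinity>\<close> in the extended reals, only an inequality survives in general.
\<close>

lemma ext_integral_shift_le:
  assumes c: "(\<lambda>t. indicator {0..} t * c t) \<in> borel_measurable lebesgue" and d: "0 \<le> d"
  shows "ext_integral {0..} (\<lambda>t. c (t + d)) \<le> ext_integral {0..} c - ext_integral {0..d} c"
proof -
  have split: "(\<integral>\<^sup>+ t \<in> {0..}. ennreal (f t) \<partial>lebesgue) =
      (\<integral>\<^sup>+ t \<in> {0..d}. ennreal (f t) \<partial>lebesgue) + (\<integral>\<^sup>+ t \<in> {0..}. ennreal (f (t + d)) \<partial>lebesgue)"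
    if f: "(\<lambda>t. indicator {0..} t * f t) \<in> borel_measurable lebesgue" for f
  proof -
    have m: "(\<lambda>t. ennreal (f t) * indicator J t) \<in> borel_measurable lebesgue"
      if "J \<in> sets borel" "J \<subseteq> {0..}" for J
    proof -
      have "(\<lambda>t. ennreal (indicator J t * (indicator {0..} t * f t))) \<in> borel_measurable lebesgue"
        using borel_measurable_lebesgue_indicator[OF that(1)] f
        by (intro measurable_compose[OF _ measurable_ennreal]) (rule borel_measurable_times)
      moreover have "(\<lambda>t. ennreal (indicator J t * (indicator {0..} t * f t))) = (\<lambda>t. ennreal (f t) * indicator J t)"
        using that(2) by (auto simp: indicator_def fun_eq_iff)
      ultimately show ?thesis by (simp only:)
    qed
    have "(\<integral>\<^sup>+ t \<in> {0..}. ennreal (f t) \<partial>lebesgue) =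
        (\<integral>\<^sup>+ t. ennreal (f t) * indicator {0..d} t + ennreal (f t) * indicator {d<..} t \<partial>lebesgue)"
      using d by (intro nn_integral_cong) (auto simp: indicator_def)
    also have "\<dots> = (\<integral>\<^sup>+ t. ennreal (f t) * indicator {0..d} t \<partial>lebesgue)
        + (\<integral>\<^sup>+ t. ennreal (f t) * indicator {d<..} t \<partial>lebesgue)"
      using d by (intro nn_integral_add m) auto
    also have "(\<integral>\<^sup>+ t. ennreal (f t) * indicator {d<..} t \<partial>lebesgue) =
        (\<integral>\<^sup>+ t. ennreal (f t) * indicator {d..} t \<partial>lebesgue)"
    proof (rule nn_integral_cong_AE)
      have "AE t in lebesgue. t \<noteq> d" by (intro AE_completion AE_lborel_singleton)
      then show "AE t in lebesgue. ennreal (f t) * indicator {d<..} t = ennreal (f t) * indicator {d..} t"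
        by eventually_elim (auto simp: indicator_def)
    qed
    also have "\<dots> = (\<integral>\<^sup>+ t. ennreal (f (d + 1 * t)) * indicator {d..} (d + 1 * t) \<partial>lebesgue)"
      using nn_integral_real_affine_lebesgue[OF m, of "{d..}" 1 d] d by auto
    also have "\<dots> = (\<integral>\<^sup>+ t \<in> {0..}. ennreal (f (t + d)) \<partial>lebesgue)"
      by (intro nn_integral_cong) (auto simp: indicator_def add.commute)
    finally show ?thesis .
  qed
  have c': "(\<lambda>t. indicator {0..} t * - c t) \<in> borel_measurable lebesgue"
    using borel_measurable_uminus[OF c] by simp
  have arith: "p2 - n2 \<le> (p1 + p2) - (n1 + n2) - (p1 - n1)"
    if "0 \<le> p1" "0 \<le> p2" "0 \<le> n1" "0 \<le> n2" for p1 p2 n1 n2 :: ereal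
    using that by (cases p1; cases p2; cases n1; cases n2) auto
  show ?thesis unfolding ext_integral_def split[OF c] split[OF c'] plus_ennreal.rep_eq
    by (rule arith) simp_all
qed

text \<open>
  One half of the dynamic programming principle: the tail of the optimal trajectory is a competitor
  in the infimum that defines the value at \<open>x d\<close>, and its cost is at most the optimal cost minus the cost
  already paid on \<open>[0, d]\<close>.
\<close>

lemma V_inf_decrease_along_optimal:
  assumes E: "dim_col E = n" and B: "dim_col B = m" and S: "S \<in> carrier_mat (n + m) (n + m)"
    and xu: "(x, u) \<in> behaviour E A B" and opt: "J_inf S x u = V_inf E A B S x0"
  shows "AE d in lebesgue. 0 < d \<longrightarrow> x d \<in> consistent_initial E A B \<and>
     V_inf E A B S (x d) \<le> V_inf E A B S x0 - cost_on {0..d} S x u"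
  using AE_initial_cond_shift[OF xu]
proof eventually_elim
  case (elim d)
  show ?case
  proof
    assume d: "0 < d"
    have xL: "L1loc_vec n x" and uL: "L1loc_vec m u"
      using xu E B unfolding behaviour_def by auto
    have b: "(\<lambda>t. x (t + d), \<lambda>t. u (t + d)) \<in> behaviour E A B"
      using xu d by (intro behaviour_shift) auto
    have ic: "initial_cond E (\<lambda>t. x (t + d)) (x d)" using elim d by simp
    have "x d \<in> carrier_vec (dim_col E)" using xL d E unfolding L1loc_vec_def by simp
    then have "x d \<in> consistent_initial E A B"
      unfolding consistent_initial_def using b ic by blast
    moreover have "V_inf E A B S (x d) \<le> J_inf S (\<lambda>t. x (t + d)) (\<lambda>t. u (t + d))"
      unfolding V_inf_def using b ic by (intro Inf_lower) blast
    moreover have "\<dots> \<le> J_inf S x u - cost_on {0..d} S x u"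
      unfolding cost_on_def
      using ext_integral_shift_le[OF stage_cost_measurable[OF S xL uL], of d] d by simp
    ultimately show "x d \<in> consistent_initial E A B \<and>
        V_inf E A B S (x d) \<le> V_inf E A B S x0 - cost_on {0..d} S x u"
      unfolding opt by simp
  qed
qed

section \<open>Linear differential equations\<close>

lemma weak_derivative_classical:
  fixes f f' :: "real \<Rightarrow> real"
  assumes f: "\<And>t. (f has_real_derivative f' t) (at t)" and f': "continuous_on UNIV f'"
  shows "weak_derivative f f'"
  unfolding weak_derivative_def
proof (intro allI impI)
  fix \<phi> assume t: "test_function \<phi>"
  obtain b where b: "0 < b" "\<And>t. t \<le> 0 \<Longrightarrow> \<phi> t = 0" "\<And>t. b \<le> t \<Longrightarrow> \<phi> t = 0"
    "\<And>t. t \<le> 0 \<Longrightarrow> deriv \<phi> t = 0" "\<And>t. b \<le> t \<Longrightarrow> deriv \<phi> t = 0"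
    using test_function_supp_deriv[OF t] by metis
  have cf: "continuous_on UNIV f" using f DERIV_continuous_on by blast
  have cd: "continuous_on UNIV (deriv \<phi>)" using t test_function_deriv test_function_continuous by auto
  have cp: "continuous_on UNIV \<phi>" using t test_function_continuous by auto
  have *: "(LINT t:{0..}|lebesgue. h t * \<chi> t) = (LINT t|lborel. (h t * \<chi> t) * indicator {0..b} t)"
    if c: "continuous_on UNIV h" "continuous_on UNIV \<chi>" and 0: "\<And>t. b \<le> t \<Longrightarrow> \<chi> t = 0" for h \<chi> :: "real \<Rightarrow> real"
  proof -
    have "(\<lambda>t. indicator {0..} t *\<^sub>R (h t * \<chi> t)) = (\<lambda>t. (h t * \<chi> t) * indicator {0..b} t)"
    proof
      fix t show "indicator {0..} t *\<^sub>R (h t * \<chi> t) = (h t * \<chi> t) * indicator {0..b} t"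
        using 0[of t] by (cases "t \<le> b") (auto simp: indicator_def)
    qed
    moreover have "(\<lambda>t. (h t * \<chi> t) * indicator {0..b} t) \<in> borel_measurable lborel"
      using c by (intro borel_measurable_times borel_measurable_indicator)
        (auto simp: borel_measurable_continuous_onI)
    ultimately show ?thesis unfolding set_lebesgue_integral_def by (simp add: integral_completion)
  qed
  have "(LINT t|lborel. (f t * deriv \<phi> t) * indicator {0..b} t) =
      f b * \<phi> b - f 0 * \<phi> 0 - (LINT t|lborel. (f' t * \<phi> t) * indicator {0..b} t)"
    using b(1) f f' cd test_function_has_deriv[OF t]
    by (intro integral_by_parts) (auto simp: continuous_on_eq_continuous_at)
  also have "f b * \<phi> b - f 0 * \<phi> 0 = 0" using b(2)[of 0] b(3)[of b] by simp
  finally show "(LINT t:{0..}|lebesgue. f t * deriv \<phi> t) = - (LINT t:{0..}|lebesgue. f' t * \<phi> t)"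
    using *[OF cf cd b(5)] *[OF f' cp b(3)] by simp
qed

text \<open>
  The solution is the exponential series \<open>\<xi>(t) = \<Sum>\<^sub>j (t\<^sup>j / j!) C\<^sup>j x\<^sub>0\<close>, taken entry by entry. The sum of the
  moduli of the entries grows at most by the factor \<open>c\<close>, the sum of the moduli of the entries of \<open>C\<close>,
  with every application of \<open>C\<close>, so each entry is dominated by the series of \<open>exp (c \<bar>t\<bar>)\<close>.
\<close>

lemma linear_ode_solution:
  fixes C :: "real mat"
  assumes C: "C \<in> carrier_mat k k" and x0: "x0 \<in> carrier_vec k"
  obtains \<xi> where "\<And>t. \<xi> t \<in> carrier_vec k" "\<xi> 0 = x0"
    "\<And>i t. i < k \<Longrightarrow> ((\<lambda>t. \<xi> t $ i) has_real_derivative (C *\<^sub>v \<xi> t) $ i) (at t)"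
proof -
  define v where "v j = (((*\<^sub>v) C) ^^ j) x0" for j
  have v0: "v 0 = x0" and vS: "v (Suc j) = C *\<^sub>v v j" for j by (auto simp: v_def)
  have vc: "v j \<in> carrier_vec k" for j
    by (induction j) (use x0 C in \<open>auto simp: v0 vS\<close>)
  have vSi: "v (Suc j) $ i = (\<Sum>l<k. C $$ (i, l) * v j $ l)" if "i < k" for i j
    using that C vc[of j] by (auto simp: vS scalar_prod_def atLeast0LessThan intro!: sum.cong)
  define c where "c = (\<Sum>i<k. \<Sum>l<k. \<bar>C $$ (i, l)\<bar>)"
  define s where "s j = (\<Sum>i<k. \<bar>v j $ i\<bar>)" for j
  have s0: "0 \<le> s j" for j by (auto simp: s_def intro: sum_nonneg)
  have c0: "0 \<le> c" by (auto simp: c_def intro: sum_nonneg)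
  have sS: "s (Suc j) \<le> c * s j" for j
  proof -
    have "s (Suc j) = (\<Sum>i<k. \<bar>\<Sum>l<k. C $$ (i, l) * v j $ l\<bar>)" by (simp add: s_def vSi)
    also have "\<dots> \<le> (\<Sum>i<k. \<Sum>l<k. \<bar>C $$ (i, l)\<bar> * s j)"
    proof (rule sum_mono)
      fix i assume "i \<in> {..<k}"
      have "\<bar>\<Sum>l<k. C $$ (i, l) * v j $ l\<bar> \<le> (\<Sum>l<k. \<bar>C $$ (i, l) * v j $ l\<bar>)" by (rule sum_abs)
      also have "\<dots> \<le> (\<Sum>l<k. \<bar>C $$ (i, l)\<bar> * s j)"
      proof (rule sum_mono)
        fix l assume "l \<in> {..<k}"
        then have "\<bar>v j $ l\<bar> \<le> s j" unfolding s_def by (intro member_le_sum) auto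
        then show "\<bar>C $$ (i, l) * v j $ l\<bar> \<le> \<bar>C $$ (i, l)\<bar> * s j"
          by (simp add: abs_mult mult_left_mono)
      qed
      finally show "\<bar>\<Sum>l<k. C $$ (i, l) * v j $ l\<bar> \<le> (\<Sum>l<k. \<bar>C $$ (i, l)\<bar> * s j)" .
    qed
    also have "\<dots> = c * s j" by (simp add: c_def sum_distrib_right)
    finally show ?thesis .
  qed
  have sb: "s j \<le> c ^ j * s 0" for j
  proof (induction j)
    case (Suc j)
    have "s (Suc j) \<le> c * s j" by (rule sS)
    also have "\<dots> \<le> c * (c ^ j * s 0)" using Suc c0 by (rule mult_left_mono)
    finally show ?case by (simp add: mult.assoc)
  qed simp
  define a where "a i j = v j $ i / fact j" for i j
  have summ: "summable (\<lambda>j. a i j * t ^ j)" if "i < k" for i t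
  proof (rule summable_comparison_test')
    show "summable (\<lambda>j. s 0 * (inverse (fact j) * (c * \<bar>t\<bar>) ^ j))"
      by (intro summable_mult summable_exp)
    fix j :: nat
    have "\<bar>v j $ i\<bar> \<le> s j" unfolding s_def by (rule member_le_sum) (use that in auto)
    also have "\<dots> \<le> c ^ j * s 0" by (rule sb)
    finally have "\<bar>v j $ i\<bar> * (\<bar>t\<bar> ^ j / fact j) \<le> c ^ j * s 0 * (\<bar>t\<bar> ^ j / fact j)"
      by (rule mult_right_mono) simp
    then show "norm (a i j * t ^ j) \<le> s 0 * (inverse (fact j) * (c * \<bar>t\<bar>) ^ j)"
      by (simp add: a_def abs_mult power_abs power_mult_distrib divide_inverse mult_ac)
  qed
  define \<xi> where "\<xi> t = Matrix.vec k (\<lambda>i. \<Sum>j. a i j * t ^ j)" for t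
  have deriv: "((\<lambda>t. \<xi> t $ i) has_real_derivative (C *\<^sub>v \<xi> t) $ i) (at t)" if i: "i < k" for i t
  proof -
    have "((\<lambda>t. \<Sum>j. a i j * t ^ j) has_real_derivative (\<Sum>j. diffs (a i) j * t ^ j)) (at t)"
      by (rule termdiffs_strong_converges_everywhere) (rule summ[OF i])
    moreover have "(\<Sum>j. diffs (a i) j * t ^ j) = (C *\<^sub>v \<xi> t) $ i"
    proof -
      have "diffs (a i) j * t ^ j = (\<Sum>l<k. C $$ (i, l) * (a l j * t ^ j))" for j
      proof -
        have "diffs (a i) j = (\<Sum>l<k. C $$ (i, l) * v j $ l) / fact j"
          unfolding diffs_def a_def vSi[OF i] fact_Suc by (simp del: of_nat_Suc)
        then show ?thesis by (simp add: a_def sum_divide_distrib sum_distrib_right mult.assoc)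
      qed
      then have "(\<Sum>j. diffs (a i) j * t ^ j) = (\<Sum>j. \<Sum>l<k. C $$ (i, l) * (a l j * t ^ j))" by simp
      also have "\<dots> = (\<Sum>l<k. \<Sum>j. C $$ (i, l) * (a l j * t ^ j))"
        by (intro suminf_sum summable_mult summ) auto
      also have "\<dots> = (\<Sum>l<k. C $$ (i, l) * (\<Sum>j. a l j * t ^ j))"
        by (intro sum.cong refl suminf_mult summ) auto
      also have "\<dots> = (C *\<^sub>v \<xi> t) $ i"
        using i C by (auto simp: \<xi>_def scalar_prod_def atLeast0LessThan intro!: sum.cong)
      finally show ?thesis .
    qed
    ultimately show ?thesis using i by (simp add: \<xi>_def)
  qed
  show ?thesis
  proof (rule that)
    show "\<xi> t \<in> carrier_vec k" for t by (simp add: \<xi>_def)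
    show "\<xi> 0 = x0"
    proof (rule eq_vecI)
      fix i assume "i < dim_vec x0"
      moreover have "(\<Sum>j. a i j * 0 ^ j) = a i 0" by (rule powser_zero)
      moreover have "a i 0 = x0 $ i" by (simp add: a_def v0)
      ultimately show "\<xi> 0 $ i = x0 $ i" using x0 by (simp add: \<xi>_def)
    qed (use x0 in \<open>simp add: \<xi>_def\<close>)
  qed (rule deriv)
qed

section \<open>Block matrices and definite matrices\<close>

lemma append_cols_carrier [simp, intro]:
  "A \<in> carrier_mat k n1 \<Longrightarrow> B \<in> carrier_mat k n2 \<Longrightarrow> append_cols A B \<in> carrier_mat k (n1 + n2)"
  unfolding append_cols_def using four_block_carrier_mat[of A k n1 "0\<^sub>m 0 n2" 0 n2] by simp

lemma append_cols_mult_vec: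
  fixes A B :: "'a :: comm_ring_1 mat"
  assumes A: "A \<in> carrier_mat k n1" and B: "B \<in> carrier_mat k n2"
    and a: "a \<in> carrier_vec n1" and b: "b \<in> carrier_vec n2"
  shows "append_cols A B *\<^sub>v (a @\<^sub>v b) = A *\<^sub>v a + B *\<^sub>v b"
proof -
  have "append_cols A B *\<^sub>v (a @\<^sub>v b)
      = (A *\<^sub>v a + B *\<^sub>v b) @\<^sub>v (0\<^sub>m 0 n1 *\<^sub>v a + 0\<^sub>m 0 n2 *\<^sub>v b)"
    unfolding append_cols_def using A B a b
    by (simp add: four_block_mat_mult_vec[of A k n1 B n2 _ 0])
  also have "\<dots> = A *\<^sub>v a + B *\<^sub>v b" using A B a b by (intro eq_vecI) auto
  finally show ?thesis .
qed

lemma append_vec_assoc: "(a @\<^sub>v b) @\<^sub>v c = a @\<^sub>v (b @\<^sub>v c)"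
  by (intro eq_vecI) auto

lemma mat_inv_of_det_nonzero:
  assumes A: "A \<in> carrier_mat k k" and det: "det A \<noteq> 0"
  shows "A * mat_inv A = 1\<^sub>m k" "mat_inv A \<in> carrier_mat k k"
proof -
  have "A \<in> Units (ring_mat TYPE(real) k ())"
    using A det by (rule det_non_zero_imp_unit)
  then obtain B where "mat_inverse A = Some B"
    using mat_inverse(1)[OF A, of "()"] by (cases "mat_inverse A") auto
  with mat_inverse(2)[OF A this] show "A * mat_inv A = 1\<^sub>m k" "mat_inv A \<in> carrier_mat k k" by auto
qed

lemma det_nonzero_of_invertible:
  fixes A :: "real mat"
  assumes A: "A \<in> carrier_mat k k" and inv: "invertible_mat A" shows "det A \<noteq> 0"
proof -
  obtain B where B: "A * B = 1\<^sub>m k" "B * A = 1\<^sub>m (dim_row B)"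
    using inv A unfolding invertible_mat_def inverts_mat_def by auto
  have "dim_col (A * B) = k" using B(1) by simp
  moreover have "dim_col (B * A) = dim_row B" using B(2) by simp
  ultimately have Bc: "B \<in> carrier_mat k k" using A by (intro carrier_matI) auto
  have "det A * det B = 1" using det_mult[OF A Bc] B(1) by simp
  then show ?thesis by auto
qed

lemma det_nonzero_of_pos_def:
  assumes R: "R \<in> carrier_mat k k" and pd: "pos_def R" shows "det R \<noteq> 0"
proof
  assume "det R = 0"
  then obtain v where v: "v \<in> carrier_vec k" "v \<noteq> 0\<^sub>v k" "R *\<^sub>v v = 0\<^sub>v k"
    using det_0_iff_vec_prod_zero[OF R] by blast
  then have "0 < v \<bullet> (R *\<^sub>v v)" using pd R unfolding pos_def_def by auto
  with v show False by simp
qed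

lemma symmetric_scalar_prod:
  fixes P :: "real mat"
  assumes P: "P \<in> carrier_mat k k" "transpose_mat P = P" and x: "x \<in> carrier_vec k" and y: "y \<in> carrier_vec k"
  shows "x \<bullet> (P *\<^sub>v y) = (P *\<^sub>v x) \<bullet> y"
  using transpose_vec_mult_scalar[OF P(1) y x] P(2) by simp

text \<open>
  Let \<open>v = a + \<i> b\<close> be a complex eigenvector for \<open>z\<close>. Symmetry of \<open>P\<close> in \<open>a \<bullet> P b = P a \<bullet> b\<close> gives
  \<open>Im z (a \<bullet> a + b \<bullet> b) = 0\<close>. Hence \<open>z\<close> is real, and whichever of \<open>a\<close>, \<open>b\<close> is nonzero is a real
  eigenvector.
\<close>

lemma symmetric_real_eigenvalue:
  fixes P :: "real mat"
  assumes P: "P \<in> carrier_mat k k" and sym: "transpose_mat P = P" and k: "0 < k"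
  obtains r where "eigenvalue P r"
proof -
  let ?Pc = "map_mat complex_of_real P"
  have Pc: "?Pc \<in> carrier_mat k k" using P by simp
  obtain z where "eigenvalue ?Pc z" using spectrum_non_empty[OF Pc k] unfolding spectrum_def by auto
  then obtain v where v: "v \<in> carrier_vec k" "v \<noteq> 0\<^sub>v k" "?Pc *\<^sub>v v = z \<cdot>\<^sub>v v"
    using P unfolding eigenvalue_def eigenvector_def by auto
  define a where "a = Matrix.vec k (\<lambda>i. Re (v $ i))"
  define b where "b = Matrix.vec k (\<lambda>i. Im (v $ i))"
  have ab [simp]: "a \<in> carrier_vec k" "b \<in> carrier_vec k" by (simp_all add: a_def b_def)
  have comp: "(\<Sum>j<k. complex_of_real (P $$ (i, j)) * v $ j) = z * v $ i" if i: "i < k" for i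
  proof -
    have "(?Pc *\<^sub>v v) $ i = (\<Sum>j<k. complex_of_real (P $$ (i, j)) * v $ j)"
      using P v(1) i by (auto simp: scalar_prod_def atLeast0LessThan intro!: sum.cong)
    then show ?thesis using v(1,3) i by simp
  qed
  have Pa: "P *\<^sub>v a = Re z \<cdot>\<^sub>v a - Im z \<cdot>\<^sub>v b"
  proof (rule eq_vecI)
    fix i assume "i < dim_vec (Re z \<cdot>\<^sub>v a - Im z \<cdot>\<^sub>v b)"
    then have i: "i < k" by (simp add: b_def)
    have "(P *\<^sub>v a) $ i = Re (\<Sum>j<k. complex_of_real (P $$ (i, j)) * v $ j)"
      using P i by (auto simp: a_def scalar_prod_def atLeast0LessThan intro!: sum.cong)
    then show "(P *\<^sub>v a) $ i = (Re z \<cdot>\<^sub>v a - Im z \<cdot>\<^sub>v b) $ i"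
      using i by (simp add: comp a_def b_def)
  qed (use P in \<open>simp add: b_def\<close>)
  have Pb: "P *\<^sub>v b = Re z \<cdot>\<^sub>v b + Im z \<cdot>\<^sub>v a"
  proof (rule eq_vecI)
    fix i assume "i < dim_vec (Re z \<cdot>\<^sub>v b + Im z \<cdot>\<^sub>v a)"
    then have i: "i < k" by (simp add: a_def)
    have "(P *\<^sub>v b) $ i = Im (\<Sum>j<k. complex_of_real (P $$ (i, j)) * v $ j)"
      using P i by (auto simp: b_def scalar_prod_def atLeast0LessThan intro!: sum.cong)
    then show "(P *\<^sub>v b) $ i = (Re z \<cdot>\<^sub>v b + Im z \<cdot>\<^sub>v a) $ i"
      using i by (simp add: comp a_def b_def)
  qed (use P in \<open>simp add: a_def\<close>)
  have "a \<bullet> (P *\<^sub>v b) = (P *\<^sub>v a) \<bullet> b" using P sym by (intro symmetric_scalar_prod) auto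
  then have "Re z * (a \<bullet> b) + Im z * (a \<bullet> a) = Re z * (a \<bullet> b) - Im z * (b \<bullet> b)"
    unfolding Pa Pb by (simp add: scalar_prod_add_distrib[of _ k] minus_scalar_prod_distrib[of _ k]
        smult_scalar_prod_distrib[of _ k] scalar_prod_smult_distrib[of _ k])
  then have "Im z * (a \<bullet> a + b \<bullet> b) = 0" by (simp add: algebra_simps)
  moreover have "a \<bullet> a + b \<bullet> b \<noteq> 0"
  proof
    assume s: "a \<bullet> a + b \<bullet> b = 0"
    have "0 \<le> w \<bullet> w" if "w \<in> carrier_vec k" for w :: "real Matrix.vec"
      using that by (auto simp: scalar_prod_def intro: sum_nonneg)
    from this[of a] this[of b] s have "a \<bullet> a = 0" "b \<bullet> b = 0" by auto
    then have "(\<Sum>i<k. a $ i * a $ i) = 0" "(\<Sum>i<k. b $ i * b $ i) = 0"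
      by (simp_all add: scalar_prod_def atLeast0LessThan a_def b_def)
    then have "a $ i = 0" "b $ i = 0" if "i < k" for i
      using that by (simp_all add: sum_nonneg_eq_0_iff)
    then have "v $ i = 0" if "i < k" for i
      using that by (simp add: a_def b_def complex_eq_iff)
    then have "v = 0\<^sub>v k" using v(1) by (intro eq_vecI) auto
    with v(2) show False by simp
  qed
  ultimately have y: "Im z = 0" by simp
  have "P *\<^sub>v a = Re z \<cdot>\<^sub>v a" unfolding Pa y by (intro eq_vecI) (auto simp: a_def b_def)
  moreover have "P *\<^sub>v b = Re z \<cdot>\<^sub>v b" unfolding Pb y by (intro eq_vecI) (auto simp: a_def b_def)
  moreover have "a \<noteq> 0\<^sub>v k \<or> b \<noteq> 0\<^sub>v k"
  proof (rule ccontr)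
    assume "\<not> ?thesis"
    then have 0: "a = 0\<^sub>v k" "b = 0\<^sub>v k" by auto
    have "v $ i = 0" if "i < k" for i
      using that arg_cong[OF 0(1), of "\<lambda>w. w $ i"] arg_cong[OF 0(2), of "\<lambda>w. w $ i"]
      by (simp add: a_def b_def complex_eq_iff)
    then have "v = 0\<^sub>v k" using v(1) by (intro eq_vecI) auto
    with v(2) show False by simp
  qed
  ultimately have "eigenvalue P (Re z)" 
    unfolding eigenvalue_def eigenvector_def carrier_matD(1)[OF P] using ab by blast
  then show ?thesis by (rule that)
qed

lemma lambda_min_pos:
  assumes P: "P \<in> carrier_mat k k" and k: "0 < k" and pd: "pos_def P"
  shows "0 < lambda_min P"
proof -
  have sym: "transpose_mat P = P" using pd unfolding pos_def_def by simp
  have "finite (spectrum P)" using card_finite_spectrum(1)[OF P] .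
  moreover have "spectrum P \<noteq> {}"
    using symmetric_real_eigenvalue[OF P sym k] unfolding spectrum_def by blast
  moreover have "0 < r" if "r \<in> spectrum P" for r
  proof -
    from that obtain v where v: "v \<in> carrier_vec k" "v \<noteq> 0\<^sub>v k" "P *\<^sub>v v = r \<cdot>\<^sub>v v"
      using P unfolding spectrum_def eigenvalue_def eigenvector_def by auto
    have "0 < v \<bullet> (P *\<^sub>v v)" using pd v P unfolding pos_def_def by auto
    then have "0 < r * (v \<bullet> v)" using v by simp
    moreover have "0 \<le> v \<bullet> v" using v(1) by (auto simp: scalar_prod_def intro: sum_nonneg)
    ultimately show ?thesis by (simp add: zero_less_mult_iff)
  qed
  ultimately show ?thesis unfolding lambda_min_def by simp
qed

lemma row_sum_norm_pos:
  assumes A: "A \<in> carrier_mat p k" and nz: "A \<noteq> 0\<^sub>m p k" shows "0 < row_sum_norm A"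
proof -
  have "\<exists>i j. i < p \<and> j < k \<and> A $$ (i, j) \<noteq> 0"
  proof (rule ccontr)
    assume "\<not> ?thesis"
    then have "A = 0\<^sub>m p k" using A by (intro eq_matI) auto
    with nz show False by simp
  qed
  then obtain i j where ij: "i < p" "j < k" "A $$ (i, j) \<noteq> 0" by blast
  have "0 < \<bar>A $$ (i, j)\<bar>" using ij by simp
  also have "\<dots> \<le> (\<Sum>j<k. \<bar>A $$ (i, j)\<bar>)" using ij by (intro member_le_sum) auto
  also have "\<dots> \<le> row_sum_norm A" unfolding row_sum_norm_def using A ij by (intro Max_ge) auto
  finally show ?thesis .
qed

section \<open>The regularized system\<close>

lemma coeff_pencil_mult:
  assumes U: "U1 \<in> carrier_mat l l'" "U0 \<in> carrier_mat l l'"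
    and D: "D1 \<in> carrier_mat l' k" "D0 \<in> carrier_mat l' k" and ij: "i < l" "j < k"
  shows "coeff ((pencil U1 U0 * pencil D1 D0) $$ (i, j)) 0 = (U0 * D0) $$ (i, j)"
    "coeff ((pencil U1 U0 * pencil D1 D0) $$ (i, j)) 1 = (U0 * D1 + U1 * D0) $$ (i, j)"
    "coeff ((pencil U1 U0 * pencil D1 D0) $$ (i, j)) 2 = (U1 * D1) $$ (i, j)"
proof -
  have *: "(pencil U1 U0 * pencil D1 D0) $$ (i, j) =
      (\<Sum>h<l'. [:U0 $$ (i, h), U1 $$ (i, h):] * [:D0 $$ (h, j), D1 $$ (h, j):])"
    using U D ij by (auto simp: pencil_def scalar_prod_def atLeast0LessThan intro!: sum.cong)
  have m: "(V * W) $$ (i, j) = (\<Sum>h<l'. V $$ (i, h) * W $$ (h, j))"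
    if "V \<in> carrier_mat l l'" "W \<in> carrier_mat l' k" for V W :: "real mat"
    using that ij by (auto simp: scalar_prod_def atLeast0LessThan intro!: sum.cong)
  have pm: "[:a, b:] * [:c, d:] = [:a * c, a * d + b * c, b * d:]" for a b c d :: real by simp
  show "coeff ((pencil U1 U0 * pencil D1 D0) $$ (i, j)) 0 = (U0 * D0) $$ (i, j)"
    unfolding * pm coeff_sum m[OF U(2) D(2)] by simp
  show "coeff ((pencil U1 U0 * pencil D1 D0) $$ (i, j)) 1 = (U0 * D1 + U1 * D0) $$ (i, j)"
  proof -
    have "(U0 * D1 + U1 * D0) $$ (i, j) = (U0 * D1) $$ (i, j) + (U1 * D0) $$ (i, j)"
      using U D ij by simp
    then show ?thesis
      unfolding * pm coeff_sum by (simp only: m[OF U(2) D(1)] m[OF U(1) D(2)]) (simp add: sum.distrib)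
  qed
  show "coeff ((pencil U1 U0 * pencil D1 D0) $$ (i, j)) 2 = (U1 * D1) $$ (i, j)"
    unfolding * pm coeff_sum m[OF U(1) D(1)] by (simp add: numeral_2_eq_2)
qed

lemma const_poly_mat_eq_pencil: "const_poly_mat N = pencil (0\<^sub>m (dim_row N) (dim_col N)) N"
  by (intro eq_matI) (auto simp: const_poly_mat_def pencil_def)

text \<open>
  Comparison of the coefficients of \<open>1\<close>, \<open>s\<close> and \<open>s\<^sup>2\<close> in
  \<open>(s E' + A') T = (s U1 + U0) (s D1 + D0)\<close>. The last equation records that the left-hand side has
  degree at most one; it is what makes the factor \<open>U1\<close> harmless below.
\<close>

lemma pencil_factorization_coeffs:
  assumes c: "E' \<in> carrier_mat l k" "A' \<in> carrier_mat l k" "T \<in> carrier_mat k k"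
    "U1 \<in> carrier_mat l l" "U0 \<in> carrier_mat l l" "D1 \<in> carrier_mat l k" "D0 \<in> carrier_mat l k"
    and eq: "pencil E' A' * const_poly_mat T = pencil U1 U0 * pencil D1 D0"
  shows "A' * T = U0 * D0" "E' * T = U0 * D1 + U1 * D0" "U1 * D1 = 0\<^sub>m l k"
proof -
  have cT: "const_poly_mat T = pencil (0\<^sub>m k k) T"
    using c(3) by (simp add: const_poly_mat_eq_pencil)
  note L = coeff_pencil_mult[OF c(1,2) zero_carrier_mat c(3), folded cT]
  note R = coeff_pencil_mult[OF c(4-7)]
  show "A' * T = U0 * D0"
    using L(1) R(1) eq c by (intro eq_matI) auto
  show "E' * T = U0 * D1 + U1 * D0"
    using L(2) R(2) eq c by (intro eq_matI) auto
  show "U1 * D1 = 0\<^sub>m l k"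
    using L(3) R(3) eq c by (intro eq_matI) auto
qed

lemma zero_mult_mat_vec [simp]: "x \<in> carrier_vec c \<Longrightarrow> 0\<^sub>m k c *\<^sub>v x = 0\<^sub>v k"
  by (intro eq_vecI) auto

lemma pencil_four_block:
  assumes "A1 \<in> carrier_mat k1 c1" "B1 \<in> carrier_mat k1 c2" "C1 \<in> carrier_mat k2 c1" "D1 \<in> carrier_mat k2 c2"
    "A0 \<in> carrier_mat k1 c1" "B0 \<in> carrier_mat k1 c2" "C0 \<in> carrier_mat k2 c1" "D0 \<in> carrier_mat k2 c2"
  shows "four_block_mat (pencil A1 A0) (pencil B1 B0) (pencil C1 C0) (pencil D1 D0)
    = pencil (four_block_mat A1 B1 C1 D1) (four_block_mat A0 B0 C0 D0)"
  using assms by (intro eq_matI) (auto simp: pencil_def)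

lemma pencil_zero: "pencil (0\<^sub>m k c) (0\<^sub>m k c) = 0\<^sub>m k c"
  by (intro eq_matI) (auto simp: pencil_def)

lemma pencil_append_cols:
  assumes "E \<in> carrier_mat k c1" "A \<in> carrier_mat k c1" "B \<in> carrier_mat k c2"
  shows "append_cols (pencil E A) (const_poly_mat B) = pencil (append_cols E (0\<^sub>m k c2)) (append_cols A B)"
proof -
  have "append_cols (pencil E A) (const_poly_mat B) = four_block_mat (pencil E A) (pencil (0\<^sub>m k c2) B)
      (pencil (0\<^sub>m 0 c1) (0\<^sub>m 0 c1)) (pencil (0\<^sub>m 0 c2) (0\<^sub>m 0 c2))"
    using assms unfolding append_cols_def pencil_zero by (simp add: const_poly_mat_eq_pencil pencil_def)
  also have "\<dots> = pencil (append_cols E (0\<^sub>m k c2)) (append_cols A B)"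
    using assms by (subst pencil_four_block[of _ k c1 _ c2 _ 0]) (auto simp: append_cols_def)
  finally show ?thesis .
qed

lemma pencil_append_rows:
  assumes "M1 \<in> carrier_mat k1 c" "M0 \<in> carrier_mat k1 c" "N1 \<in> carrier_mat k2 c" "N0 \<in> carrier_mat k2 c"
  shows "pencil M1 M0 @\<^sub>r pencil N1 N0 = pencil (M1 @\<^sub>r N1) (M0 @\<^sub>r N0)"
proof -
  have "pencil M1 M0 @\<^sub>r pencil N1 N0 = four_block_mat (pencil M1 M0) (pencil (0\<^sub>m k1 0) (0\<^sub>m k1 0))
      (pencil N1 N0) (pencil (0\<^sub>m k2 0) (0\<^sub>m k2 0))"
    using assms unfolding append_rows_def pencil_zero by (simp add: pencil_def)
  also have "\<dots> = pencil (M1 @\<^sub>r N1) (M0 @\<^sub>r N0)"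
    using assms by (subst pencil_four_block[of _ k1 c _ 0 _ k2]) (auto simp: append_rows_def)
  finally show ?thesis .
qed

text \<open>
  The matrix \<open>X\<close> parametrizes by \<open>(\<xi>, v)\<close> the vectors \<open>(x, u) = T z\<close> whose coordinates \<open>z\<close> satisfy the
  algebraic rows of the regularized pencil \<open>s D1 + D0\<close>. On them \<open>D1 z = J \<xi>\<close> and
  \<open>D0 z = - J (Ah \<xi> + Bh v)\<close>, where \<open>J\<close> places a vector in the differential rows. Since \<open>U1 D1 = 0\<close>
  means \<open>U1 J = 0\<close>, the coefficient equations reduce to \<open>E x = U0 J \<xi>\<close> and
  \<open>A x + B u = U0 J (Ah \<xi> + Bh v)\<close>. Thus every solution of \<open>\<xi>' = Ah \<xi> + Bh v\<close> is carried to a solution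
  of the original system, with \<open>N = U0 J\<close>.
\<close>

lemma regularized_system_equation:
  assumes E: "E \<in> carrier_mat l n" and A: "A \<in> carrier_mat l n" and B: "B \<in> carrier_mat l m"
    and reg: "regularizing_transformation l n m E A B T nh r U1 U0 A11 A12 A21 A22 B1 B2"
    and q: "q = n + m - r"
    and Ah: "Ah = A11 - A12 * mat_inv A22 * A21"
    and Bh: "Bh = B1 - A12 * mat_inv A22 * B2"
    and X: "X = T * (four_block_mat
                    (1\<^sub>m nh)                (0\<^sub>m nh q)
                    (- (mat_inv A22 * A21)) (- (mat_inv A22 * B2))
                  @\<^sub>r append_cols (0\<^sub>m q nh) (1\<^sub>m q))"
  obtains N where "N \<in> carrier_mat l nh"
    "\<And>\<xi> v x u. \<lbrakk>\<xi> \<in> carrier_vec nh; v \<in> carrier_vec q; x \<in> carrier_vec n; u \<in> carrier_vec m;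
       X *\<^sub>v (\<xi> @\<^sub>v v) = x @\<^sub>v u\<rbrakk>
     \<Longrightarrow> E *\<^sub>v x = N *\<^sub>v \<xi> \<and> A *\<^sub>v x + B *\<^sub>v u = N *\<^sub>v (Ah *\<^sub>v \<xi> + Bh *\<^sub>v v)"
proof -
  define s where "s = r - nh"
  define Ai where "Ai = mat_inv A22"
  have dims: "nh \<le> r" "r \<le> l" "nh \<le> n" "r \<le> n + m"
    and T: "T \<in> carrier_mat (n + m) (n + m)"
    and U: "U1 \<in> carrier_mat l l" "U0 \<in> carrier_mat l l"
    and A11: "A11 \<in> carrier_mat nh nh" and A12: "A12 \<in> carrier_mat nh s"
    and A21: "A21 \<in> carrier_mat s nh" and A22: "A22 \<in> carrier_mat s s" and inv: "invertible_mat A22"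
    and B1: "B1 \<in> carrier_mat nh q" and B2: "B2 \<in> carrier_mat s q"
    and eq: "append_cols (pencil E (- A)) (const_poly_mat (- B)) * const_poly_mat T =
       pencil U1 U0 *
         (0\<^sub>m (l - r) (n + m) @\<^sub>r
          four_block_mat
            (pencil (1\<^sub>m nh) (- A11)) (const_poly_mat (append_cols (- A12) (- B1)))
            (const_poly_mat (- A21))  (const_poly_mat (append_cols (- A22) (- B2))))"
    using reg unfolding regularizing_transformation_def s_def q by auto
  have nm: "n + m = nh + (s + q)" and l: "l = (l - r) + (nh + s)"
    using dims by (auto simp: s_def q)
  have Ai: "A22 * Ai = 1\<^sub>m s" "Ai \<in> carrier_mat s s"
    using mat_inv_of_det_nonzero[OF A22 det_nonzero_of_invertible[OF A22 inv]] by (auto simp: Ai_def)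
  let ?D1' = "four_block_mat (1\<^sub>m nh) (0\<^sub>m nh (s + q)) (0\<^sub>m s nh) (0\<^sub>m s (s + q)) :: real mat"
  let ?D0' = "four_block_mat (- A11) (append_cols (- A12) (- B1)) (- A21) (append_cols (- A22) (- B2))"
  let ?Z = "0\<^sub>m (l - r) (n + m) :: real mat"
  define D1 where "D1 = ?Z @\<^sub>r ?D1'"
  define D0 where "D0 = ?Z @\<^sub>r ?D0'"
  have D1': "?D1' \<in> carrier_mat (nh + s) (n + m)" unfolding nm by (intro four_block_carrier_mat) auto
  have D0': "?D0' \<in> carrier_mat (nh + s) (n + m)"
    unfolding nm using A11 A12 A21 A22 B1 B2
    by (intro four_block_carrier_mat append_cols_carrier) auto
  have D: "D1 \<in> carrier_mat l (n + m)" "D0 \<in> carrier_mat l (n + m)"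
    using carrier_append_rows[OF zero_carrier_mat D1', of "l - r"]
      carrier_append_rows[OF zero_carrier_mat D0', of "l - r"] l
    by (simp_all add: D1_def D0_def)
  have p12: "append_cols (- A12) (- B1) \<in> carrier_mat nh (s + q)"
    and p22: "append_cols (- A22) (- B2) \<in> carrier_mat s (s + q)"
    using A12 A22 B1 B2 by auto
  have right: "0\<^sub>m (l - r) (n + m) @\<^sub>r
          four_block_mat
            (pencil (1\<^sub>m nh) (- A11)) (const_poly_mat (append_cols (- A12) (- B1)))
            (const_poly_mat (- A21))  (const_poly_mat (append_cols (- A22) (- B2))) = pencil D1 D0"
  proof -
    have "four_block_mat (pencil (1\<^sub>m nh) (- A11)) (const_poly_mat (append_cols (- A12) (- B1)))
            (const_poly_mat (- A21))  (const_poly_mat (append_cols (- A22) (- B2))) = pencil ?D1' ?D0'"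
      unfolding const_poly_mat_eq_pencil
        carrier_matD[OF p12] carrier_matD[OF p22] carrier_matD[OF uminus_carrier_mat[OF A21]]
      using A11 p12 A21 p22 by (intro pencil_four_block) auto
    then show ?thesis unfolding D1_def D0_def
      using pencil_append_rows[OF zero_carrier_mat zero_carrier_mat D1' D0', of "l - r"]
      by (simp add: pencil_zero)
  qed
  have left: "append_cols (pencil E (- A)) (const_poly_mat (- B))
      = pencil (append_cols E (0\<^sub>m l m)) (append_cols (- A) (- B))"
    using E A B by (intro pencil_append_cols) auto
  let ?E' = "append_cols E (0\<^sub>m l m)" and ?A' = "append_cols (- A) (- B)"
  have E': "?E' \<in> carrier_mat l (n + m)" and A': "?A' \<in> carrier_mat l (n + m)"
    using E A B by auto
  note coeffs = pencil_factorization_coeffs[OF E' A' T U D eq[unfolded left right]]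
  define J :: "real mat" where "J = 0\<^sub>m (l - r) nh @\<^sub>r (1\<^sub>m nh @\<^sub>r 0\<^sub>m s nh)"
  have J0: "(1\<^sub>m nh @\<^sub>r 0\<^sub>m s nh :: real mat) \<in> carrier_mat (nh + s) nh" by auto
  have J: "J \<in> carrier_mat l nh"
    using carrier_append_rows[OF zero_carrier_mat J0, of "l - r"] l by (simp add: J_def)
  have Jv: "J *\<^sub>v \<zeta> = 0\<^sub>v (l - r) @\<^sub>v (\<zeta> @\<^sub>v 0\<^sub>v s)" if z: "\<zeta> \<in> carrier_vec nh" for \<zeta>
    unfolding J_def using z
    by (simp add: mat_mult_append[OF zero_carrier_mat J0 z]
        mat_mult_append[OF one_carrier_mat zero_carrier_mat z] zero_mult_mat_vec)
  have D1v: "D1 *\<^sub>v (\<zeta> @\<^sub>v w) = J *\<^sub>v \<zeta>" if z: "\<zeta> \<in> carrier_vec nh" and w: "w \<in> carrier_vec (s + q)" for \<zeta> w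
  proof -
    have zw: "\<zeta> @\<^sub>v w \<in> carrier_vec (n + m)" unfolding nm using z w by auto
    have "?D1' *\<^sub>v (\<zeta> @\<^sub>v w) = (1\<^sub>m nh *\<^sub>v \<zeta> + 0\<^sub>m nh (s + q) *\<^sub>v w) @\<^sub>v (0\<^sub>m s nh *\<^sub>v \<zeta> + 0\<^sub>m s (s + q) *\<^sub>v w)"
      using z w by (intro four_block_mat_mult_vec) auto
    also have "\<dots> = \<zeta> @\<^sub>v 0\<^sub>v s" using z w by (simp only: zero_mult_mat_vec one_mult_mat_vec) simp
    finally show ?thesis
      unfolding D1_def mat_mult_append[OF zero_carrier_mat D1' zw] Jv[OF z] using zw by simp
  qed
  have U1J: "U1 *\<^sub>v (J *\<^sub>v \<zeta>) = 0\<^sub>v l" if z: "\<zeta> \<in> carrier_vec nh" for \<zeta>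
  proof -
    have zw: "\<zeta> @\<^sub>v 0\<^sub>v (s + q) \<in> carrier_vec (n + m)" unfolding nm using z by auto
    have "U1 *\<^sub>v (J *\<^sub>v \<zeta>) = U1 *\<^sub>v (D1 *\<^sub>v (\<zeta> @\<^sub>v 0\<^sub>v (s + q)))" using D1v[OF z] by simp
    also have "\<dots> = (U1 * D1) *\<^sub>v (\<zeta> @\<^sub>v 0\<^sub>v (s + q))"
      using assoc_mult_mat_vec[OF U(1) D(1) zw] by simp
    also have "\<dots> = 0\<^sub>v l" unfolding coeffs(3) using zw by simp
    finally show ?thesis .
  qed
  define N where "N = U0 * J"
  have N: "N \<in> carrier_mat l nh" using U J by (simp add: N_def)
  show ?thesis
  proof (rule that[OF N])
    fix \<xi> v x u :: "real Matrix.vec"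
    assume c: "\<xi> \<in> carrier_vec nh" "v \<in> carrier_vec q" "x \<in> carrier_vec n" "u \<in> carrier_vec m"
      and Xeq: "X *\<^sub>v (\<xi> @\<^sub>v v) = x @\<^sub>v u"
    define w where "w = - (Ai * A21) *\<^sub>v \<xi> + - (Ai * B2) *\<^sub>v v"
    have cA: "Ai * A21 \<in> carrier_mat s nh" "Ai * B2 \<in> carrier_mat s q" using Ai A21 B2 by auto
    have w: "w \<in> carrier_vec s" using cA c by (simp add: w_def)
    have wv: "w @\<^sub>v v \<in> carrier_vec (s + q)" using w c by auto
    define z where "z = \<xi> @\<^sub>v (w @\<^sub>v v)"
    have z: "z \<in> carrier_vec (n + m)" unfolding nm z_def using c w by auto
    let ?\<zeta> = "Ah *\<^sub>v \<xi> + Bh *\<^sub>v v"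
    have AhBh: "Ah \<in> carrier_mat nh nh" "Bh \<in> carrier_mat nh q"
      using A11 A12 Ai A21 B1 B2 unfolding Ah Bh Ai_def[symmetric] by auto
    have \<zeta>: "?\<zeta> \<in> carrier_vec nh" using AhBh c by auto
    have Tz: "T *\<^sub>v z = x @\<^sub>v u"
    proof -
      let ?Y1 = "four_block_mat (1\<^sub>m nh) (0\<^sub>m nh q) (- (Ai * A21)) (- (Ai * B2))"
      let ?Y2 = "append_cols (0\<^sub>m q nh) (1\<^sub>m q) :: real mat"
      have Y1: "?Y1 \<in> carrier_mat (nh + s) (nh + q)" using cA by (intro four_block_carrier_mat) auto
      have Y2: "?Y2 \<in> carrier_mat q (nh + q)" by auto
      have Y: "?Y1 @\<^sub>r ?Y2 \<in> carrier_mat (n + m) (nh + q)"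
        using carrier_append_rows[OF Y1 Y2] nm by (simp add: add.assoc)
      have \<xi>v: "\<xi> @\<^sub>v v \<in> carrier_vec (nh + q)" using c by auto
      have "?Y1 *\<^sub>v (\<xi> @\<^sub>v v) = (1\<^sub>m nh *\<^sub>v \<xi> + 0\<^sub>m nh q *\<^sub>v v) @\<^sub>v w"
        unfolding w_def using cA c by (intro four_block_mat_mult_vec) auto
      then have "?Y1 *\<^sub>v (\<xi> @\<^sub>v v) = \<xi> @\<^sub>v w" using c by simp
      moreover have "?Y2 *\<^sub>v (\<xi> @\<^sub>v v) = v"
        using c by (simp add: append_cols_mult_vec[OF zero_carrier_mat one_carrier_mat])
      ultimately have "(?Y1 @\<^sub>r ?Y2) *\<^sub>v (\<xi> @\<^sub>v v) = z"
        unfolding mat_mult_append[OF Y1 Y2 \<xi>v] by (simp add: z_def append_vec_assoc)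
      moreover have "X *\<^sub>v (\<xi> @\<^sub>v v) = T *\<^sub>v ((?Y1 @\<^sub>r ?Y2) *\<^sub>v (\<xi> @\<^sub>v v))"
        unfolding X Ai_def[symmetric] by (rule assoc_mult_mat_vec[OF T Y \<xi>v])
      ultimately show ?thesis using Xeq by simp
    qed
    \<comment> \<open>\<open>w\<close> solves the algebraic rows, which leaves the reduced system in the differential rows.\<close>
    have A22w: "- A21 *\<^sub>v \<xi> + (- A22 *\<^sub>v w + - B2 *\<^sub>v v) = 0\<^sub>v s"
    proof -
      have "A22 *\<^sub>v w = A22 *\<^sub>v (- (Ai * A21) *\<^sub>v \<xi>) + A22 *\<^sub>v (- (Ai * B2) *\<^sub>v v)"
        unfolding w_def using A22 cA c by (intro mult_add_distrib_mat_vec) auto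
      also have "A22 *\<^sub>v (- (Ai * A21) *\<^sub>v \<xi>) = (A22 * - (Ai * A21)) *\<^sub>v \<xi>"
        using A22 cA c by (intro assoc_mult_mat_vec[symmetric]) auto
      also have "A22 * - (Ai * A21) = - A21"
        using A22 cA Ai A21 by (simp add: assoc_mult_mat[of _ s s _ s _ nh, symmetric])
      also have "A22 *\<^sub>v (- (Ai * B2) *\<^sub>v v) = (A22 * - (Ai * B2)) *\<^sub>v v"
        using A22 cA c by (intro assoc_mult_mat_vec[symmetric]) auto
      also have "A22 * - (Ai * B2) = - B2"
        using A22 cA Ai B2 by (simp add: assoc_mult_mat[of _ s s _ s _ q, symmetric])
      finally have e: "A22 *\<^sub>v w = - A21 *\<^sub>v \<xi> + - B2 *\<^sub>v v" .
      have "- A22 *\<^sub>v w = - (A22 *\<^sub>v w)" using A22 w by simp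
      then show ?thesis unfolding e using A21 B2 c by (intro eq_vecI) auto
    qed
    have A12w: "- A11 *\<^sub>v \<xi> + (- A12 *\<^sub>v w + - B1 *\<^sub>v v) = - ?\<zeta>"
    proof -
      have "A12 *\<^sub>v w = A12 *\<^sub>v (- (Ai * A21) *\<^sub>v \<xi>) + A12 *\<^sub>v (- (Ai * B2) *\<^sub>v v)"
        unfolding w_def using A12 cA c by (intro mult_add_distrib_mat_vec) auto
      also have "A12 *\<^sub>v (- (Ai * A21) *\<^sub>v \<xi>) = (A12 * - (Ai * A21)) *\<^sub>v \<xi>"
        using A12 cA c by (intro assoc_mult_mat_vec[symmetric]) auto
      also have "A12 * - (Ai * A21) = - (A12 * Ai * A21)"
        using A12 cA Ai A21 by (simp add: assoc_mult_mat[of _ nh s _ s _ nh])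
      also have "A12 *\<^sub>v (- (Ai * B2) *\<^sub>v v) = (A12 * - (Ai * B2)) *\<^sub>v v"
        using A12 cA c by (intro assoc_mult_mat_vec[symmetric]) auto
      also have "A12 * - (Ai * B2) = - (A12 * Ai * B2)"
        using A12 cA Ai B2 by (simp add: assoc_mult_mat[of _ nh s _ s _ q])
      finally have e: "A12 *\<^sub>v w = - (A12 * Ai * A21) *\<^sub>v \<xi> + - (A12 * Ai * B2) *\<^sub>v v" .
      have c3: "A12 * Ai * A21 \<in> carrier_mat nh nh" "A12 * Ai * B2 \<in> carrier_mat nh q"
        using A12 Ai A21 B2 by auto
      have neg: "- A12 *\<^sub>v w = - (- ((A12 * Ai * A21) *\<^sub>v \<xi>) + - ((A12 * Ai * B2) *\<^sub>v v))"
        using A12 A21 B2 w c by (simp add: e)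
      have split: "?\<zeta> = (A11 *\<^sub>v \<xi> - (A12 * Ai * A21) *\<^sub>v \<xi>) + (B1 *\<^sub>v v - (A12 * Ai * B2) *\<^sub>v v)"
        unfolding Ah Bh Ai_def[symmetric]
        using minus_mult_distrib_mat_vec[OF A11 c3(1) c(1)] minus_mult_distrib_mat_vec[OF B1 c3(2) c(2)] by simp
      have alg: "- a + (- (- b + - d) + - y) = - ((a - b) + (y - d))"
        if "a \<in> carrier_vec nh" "b \<in> carrier_vec nh" "y \<in> carrier_vec nh" "d \<in> carrier_vec nh"
        for a b y d :: "real Matrix.vec"
        using that by (intro eq_vecI) auto
      have "- A11 *\<^sub>v \<xi> = - (A11 *\<^sub>v \<xi>)" "- B1 *\<^sub>v v = - (B1 *\<^sub>v v)" using A11 B1 c by simp_all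
      then show ?thesis unfolding split neg using A11 B1 c3 c by (simp only:) (intro alg, auto)
    qed
    have D0z: "D0 *\<^sub>v z = - (J *\<^sub>v ?\<zeta>)"
    proof -
      have "?D0' *\<^sub>v z = (- A11 *\<^sub>v \<xi> + append_cols (- A12) (- B1) *\<^sub>v (w @\<^sub>v v)) @\<^sub>v
          (- A21 *\<^sub>v \<xi> + append_cols (- A22) (- B2) *\<^sub>v (w @\<^sub>v v))"
        unfolding z_def using A11 p12 A21 p22 c wv by (intro four_block_mat_mult_vec) auto
      also have "append_cols (- A12) (- B1) *\<^sub>v (w @\<^sub>v v) = - A12 *\<^sub>v w + - B1 *\<^sub>v v"
        using A12 B1 w c by (intro append_cols_mult_vec) auto
      also have "append_cols (- A22) (- B2) *\<^sub>v (w @\<^sub>v v) = - A22 *\<^sub>v w + - B2 *\<^sub>v v"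
        using A22 B2 w c by (intro append_cols_mult_vec) auto
      finally have "?D0' *\<^sub>v z = - ?\<zeta> @\<^sub>v 0\<^sub>v s" unfolding A22w A12w .
      then have "D0 *\<^sub>v z = 0\<^sub>v (l - r) @\<^sub>v (- ?\<zeta> @\<^sub>v 0\<^sub>v s)"
        unfolding D0_def mat_mult_append[OF zero_carrier_mat D0' z] using z by simp
      also have "\<dots> = - (J *\<^sub>v ?\<zeta>)" unfolding Jv[OF \<zeta>] using \<zeta> by (intro eq_vecI) auto
      finally show ?thesis .
    qed
    have Jc: "J *\<^sub>v \<xi> \<in> carrier_vec l" "J *\<^sub>v ?\<zeta> \<in> carrier_vec l" using J by (auto intro: mult_mat_vec_carrier c(1) \<zeta>)
    have neg: "W *\<^sub>v (- y) = - (W *\<^sub>v y)" if "W \<in> carrier_mat l l" "y \<in> carrier_vec l" for W :: "real mat" and y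
      using that by (intro eq_vecI) auto
    have "E *\<^sub>v x = ?E' *\<^sub>v (x @\<^sub>v u)"
      using E c by (simp add: append_cols_mult_vec[OF E zero_carrier_mat c(3,4)])
    also have "\<dots> = (?E' * T) *\<^sub>v z" unfolding Tz[symmetric] by (rule assoc_mult_mat_vec[OF E' T z, symmetric])
    also have "\<dots> = (U0 * D1) *\<^sub>v z + (U1 * D0) *\<^sub>v z"
      unfolding coeffs(2) using U D z by (intro add_mult_distrib_mat_vec) auto
    also have "(U0 * D1) *\<^sub>v z = U0 *\<^sub>v (J *\<^sub>v \<xi>)"
      using assoc_mult_mat_vec[OF U(2) D(1) z] D1v[OF c(1) wv] by (simp add: z_def)
    also have "(U1 * D0) *\<^sub>v z = - (U1 *\<^sub>v (J *\<^sub>v ?\<zeta>))"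
      unfolding assoc_mult_mat_vec[OF U(1) D(2) z] D0z by (rule neg[OF U(1) Jc(2)])
    also have "U0 *\<^sub>v (J *\<^sub>v \<xi>) + - (U1 *\<^sub>v (J *\<^sub>v ?\<zeta>)) = U0 *\<^sub>v (J *\<^sub>v \<xi>)"
      unfolding U1J[OF \<zeta>] using U(2) by (intro eq_vecI) auto
    also have "\<dots> = N *\<^sub>v \<xi>" unfolding N_def by (rule assoc_mult_mat_vec[OF U(2) J c(1), symmetric])
    finally have first: "E *\<^sub>v x = N *\<^sub>v \<xi>" .
    have "- A *\<^sub>v x + - B *\<^sub>v u = ?A' *\<^sub>v (x @\<^sub>v u)"
      using A B c by (intro append_cols_mult_vec[symmetric]) auto
    also have "\<dots> = (?A' * T) *\<^sub>v z" unfolding Tz[symmetric] by (rule assoc_mult_mat_vec[OF A' T z, symmetric])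
    also have "\<dots> = - (U0 *\<^sub>v (J *\<^sub>v ?\<zeta>))"
      unfolding coeffs(1) assoc_mult_mat_vec[OF U(2) D(2) z] D0z by (rule neg[OF U(2) Jc(2)])
    also have "U0 *\<^sub>v (J *\<^sub>v ?\<zeta>) = N *\<^sub>v ?\<zeta>" unfolding N_def by (rule assoc_mult_mat_vec[OF U(2) J \<zeta>, symmetric])
    finally have "- (- A *\<^sub>v x + - B *\<^sub>v u) = N *\<^sub>v ?\<zeta>" using N by (simp add: uminus_uminus_vec)
    moreover have "- (- A *\<^sub>v x + - B *\<^sub>v u) = A *\<^sub>v x + B *\<^sub>v u"
      using A B c by (intro eq_vecI) auto
    ultimately show "E *\<^sub>v x = N *\<^sub>v \<xi> \<and> A *\<^sub>v x + B *\<^sub>v u = N *\<^sub>v ?\<zeta>" using first by simp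
  qed
qed

section \<open>Invariant sublevel sets under the Riccati feedback\<close>

text \<open>
  The Riccati equation turns \<open>2 P \<xi> \<bullet> (A \<xi> + B v)\<close>, the derivative of \<open>\<xi> \<bullet> P \<xi>\<close> along the closed loop,
  into the negative of the stage cost \<open>(\<xi>, v) \<bullet> S (\<xi>, v)\<close>, where \<open>S\<close> is the block matrix of \<open>Q\<close>, \<open>H\<close>
  and \<open>R\<close>. With \<open>y = (B\<^sup>T P + H\<^sup>T) \<xi>\<close> the feedback satisfies \<open>R v = - y\<close>, and all mixed terms are
  expressed through \<open>y \<bullet> v\<close>.
\<close>

lemma riccati_feedback_dissipative:
  fixes A B Q H R P :: "real mat"
  assumes A: "A \<in> carrier_mat k k" and B: "B \<in> carrier_mat k q" and Q: "Q \<in> carrier_mat k k"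
    and H: "H \<in> carrier_mat k q" and R: "R \<in> carrier_mat q q" and P: "P \<in> carrier_mat k k"
    and pdR: "pos_def R" and sym: "transpose_mat P = P"
    and psd: "pos_semidef (four_block_mat Q H (transpose_mat H) R)"
    and ric: "transpose_mat A * P + P * A + Q
           - (P * B + H) * mat_inv R * transpose_mat (P * B + H) = 0\<^sub>m k k"
    and \<xi>: "\<xi> \<in> carrier_vec k"
    and v: "v = - (mat_inv R * (transpose_mat B * P + transpose_mat H)) *\<^sub>v \<xi>"
  shows "(P *\<^sub>v \<xi>) \<bullet> (A *\<^sub>v \<xi> + B *\<^sub>v v) \<le> 0"
proof -
  define Ri where "Ri = mat_inv R"
  have Ri: "R * Ri = 1\<^sub>m q" "Ri \<in> carrier_mat q q"
    using mat_inv_of_det_nonzero[OF R det_nonzero_of_pos_def[OF R pdR]] by (auto simp: Ri_def)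
  define W where "W = P * B + H"
  define L where "L = transpose_mat B * P + transpose_mat H"
  have W: "W \<in> carrier_mat k q" using P B H by (simp add: W_def)
  have WL: "transpose_mat W = L"
    unfolding W_def L_def using P B H sym by (simp add: transpose_add[of _ k q] transpose_mult[of _ k k])
  have L: "L \<in> carrier_mat q k" using B P H by (simp add: L_def)
  define y where "y = L *\<^sub>v \<xi>"
  have y: "y \<in> carrier_vec q" using L \<xi> by (simp add: y_def)
  have vy: "v = - (Ri *\<^sub>v y)"
    unfolding v Ri_def[symmetric] L_def[symmetric] y_def
    using Ri L \<xi> by (simp add: assoc_mult_mat_vec[of _ q q _ k])
  have vc: "v \<in> carrier_vec q" unfolding vy using Ri y by simp
  have Rv: "R *\<^sub>v v = - y"
  proof -
    have "R *\<^sub>v v = - (R *\<^sub>v (Ri *\<^sub>v y))" unfolding vy using R Ri y by (intro eq_vecI) auto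
    also have "R *\<^sub>v (Ri *\<^sub>v y) = (R * Ri) *\<^sub>v y" using R Ri y by (intro assoc_mult_mat_vec[symmetric]) auto
    finally show ?thesis using Ri y by simp
  qed
  define p where "p = P *\<^sub>v \<xi>"
  have p: "p \<in> carrier_vec k" using P \<xi> by (simp add: p_def)
  have ywv: "y \<bullet> v = p \<bullet> (B *\<^sub>v v) + \<xi> \<bullet> (H *\<^sub>v v)"
  proof -
    have "y = transpose_mat B *\<^sub>v p + transpose_mat H *\<^sub>v \<xi>"
    proof -
      have "y = (transpose_mat B * P) *\<^sub>v \<xi> + transpose_mat H *\<^sub>v \<xi>"
        unfolding y_def L_def using B P H \<xi> by (intro add_mult_distrib_mat_vec) auto
      also have "(transpose_mat B * P) *\<^sub>v \<xi> = transpose_mat B *\<^sub>v p"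
        unfolding p_def using B P \<xi> by (intro assoc_mult_mat_vec) auto
      finally show ?thesis .
    qed
    then have "y \<bullet> v = (transpose_mat B *\<^sub>v p) \<bullet> v + (transpose_mat H *\<^sub>v \<xi>) \<bullet> v"
      using B H p \<xi> vc by (simp add: add_scalar_prod_distrib[of _ q])
    then show ?thesis
      using transpose_vec_mult_scalar[OF B vc p] transpose_vec_mult_scalar[OF H vc \<xi>] by simp
  qed
  have ric': "2 * (p \<bullet> (A *\<^sub>v \<xi>)) + \<xi> \<bullet> (Q *\<^sub>v \<xi>) + y \<bullet> v = 0"
  proof -
    let ?M = "W * Ri * L"
    have M: "?M \<in> carrier_mat k k" using W Ri L by auto
    have "0 = \<xi> \<bullet> (0\<^sub>m k k *\<^sub>v \<xi>)" using \<xi> by (simp add: zero_mult_mat_vec)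
    also have "0\<^sub>m k k *\<^sub>v \<xi> = (transpose_mat A * P + P * A + Q - ?M) *\<^sub>v \<xi>"
      using ric unfolding W_def[symmetric] WL Ri_def[symmetric] by simp
    also have "\<dots> = (transpose_mat A * P + P * A + Q) *\<^sub>v \<xi> - ?M *\<^sub>v \<xi>"
      using A P Q M \<xi> by (intro minus_mult_distrib_mat_vec) auto
    also have "(transpose_mat A * P + P * A + Q) *\<^sub>v \<xi> = (transpose_mat A * P) *\<^sub>v \<xi> + (P * A) *\<^sub>v \<xi> + Q *\<^sub>v \<xi>"
      using A P Q \<xi> by (simp add: add_mult_distrib_mat_vec[of _ k k])
    also have "(transpose_mat A * P) *\<^sub>v \<xi> = transpose_mat A *\<^sub>v p"
      unfolding p_def using A P \<xi> by (intro assoc_mult_mat_vec) auto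
    also have "(P * A) *\<^sub>v \<xi> = P *\<^sub>v (A *\<^sub>v \<xi>)" using A P \<xi> by (intro assoc_mult_mat_vec) auto
    also have "?M *\<^sub>v \<xi> = W *\<^sub>v (Ri *\<^sub>v y)"
      unfolding y_def using W Ri L \<xi> by (simp add: assoc_mult_mat_vec[of _ k q _ k] assoc_mult_mat_vec[of _ k q _ q])
    also have "\<xi> \<bullet> (transpose_mat A *\<^sub>v p + P *\<^sub>v (A *\<^sub>v \<xi>) + Q *\<^sub>v \<xi> - W *\<^sub>v (Ri *\<^sub>v y))
        = \<xi> \<bullet> (transpose_mat A *\<^sub>v p) + \<xi> \<bullet> (P *\<^sub>v (A *\<^sub>v \<xi>)) + \<xi> \<bullet> (Q *\<^sub>v \<xi>) - \<xi> \<bullet> (W *\<^sub>v (Ri *\<^sub>v y))"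
      using A P Q W Ri y p \<xi> by (simp add: scalar_prod_add_distrib[of _ k] scalar_prod_minus_distrib[of _ k])
    also have "\<xi> \<bullet> (transpose_mat A *\<^sub>v p) = p \<bullet> (A *\<^sub>v \<xi>)"
      using transpose_vec_mult_scalar[OF A \<xi> p] comm_scalar_prod[of \<xi> k "transpose_mat A *\<^sub>v p"] A p \<xi> by simp
    also have "\<xi> \<bullet> (P *\<^sub>v (A *\<^sub>v \<xi>)) = p \<bullet> (A *\<^sub>v \<xi>)"
      unfolding p_def using P sym A \<xi> by (intro symmetric_scalar_prod) auto
    also have "\<xi> \<bullet> (W *\<^sub>v (Ri *\<^sub>v y)) = y \<bullet> (Ri *\<^sub>v y)"
      using transpose_vec_mult_scalar[OF W _ \<xi>, of "Ri *\<^sub>v y"] Ri y unfolding WL y_def[symmetric] by simp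
    also have "y \<bullet> (Ri *\<^sub>v y) = - (y \<bullet> v)" unfolding vy using Ri y by simp
    finally show ?thesis by simp
  qed
  have "0 \<le> (\<xi> @\<^sub>v v) \<bullet> (four_block_mat Q H (transpose_mat H) R *\<^sub>v (\<xi> @\<^sub>v v))"
    using psd Q R \<xi> vc unfolding pos_semidef_def by auto
  also have "four_block_mat Q H (transpose_mat H) R *\<^sub>v (\<xi> @\<^sub>v v)
      = (Q *\<^sub>v \<xi> + H *\<^sub>v v) @\<^sub>v (transpose_mat H *\<^sub>v \<xi> + R *\<^sub>v v)"
    using Q H R \<xi> vc by (intro four_block_mat_mult_vec) auto
  also have "(\<xi> @\<^sub>v v) \<bullet> \<dots> = \<xi> \<bullet> (Q *\<^sub>v \<xi> + H *\<^sub>v v) + v \<bullet> (transpose_mat H *\<^sub>v \<xi> + R *\<^sub>v v)"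
    using Q H R \<xi> vc by (intro scalar_prod_append) auto
  also have "\<dots> = \<xi> \<bullet> (Q *\<^sub>v \<xi>) + \<xi> \<bullet> (H *\<^sub>v v) + (v \<bullet> (transpose_mat H *\<^sub>v \<xi>) + v \<bullet> (R *\<^sub>v v))"
    using Q H R \<xi> vc by (simp add: scalar_prod_add_distrib[of _ k] scalar_prod_add_distrib[of _ q])
  also have "v \<bullet> (transpose_mat H *\<^sub>v \<xi>) = \<xi> \<bullet> (H *\<^sub>v v)"
    using transpose_vec_mult_scalar[OF H vc \<xi>] comm_scalar_prod[of v q "transpose_mat H *\<^sub>v \<xi>"] H \<xi> vc by simp
  also have "v \<bullet> (R *\<^sub>v v) = - (y \<bullet> v)"
    unfolding Rv using y vc comm_scalar_prod[of v q y] by simp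
  finally have "0 \<le> \<xi> \<bullet> (Q *\<^sub>v \<xi>) + 2 * (\<xi> \<bullet> (H *\<^sub>v v)) - y \<bullet> v" by simp
  moreover have "p \<bullet> (A *\<^sub>v \<xi> + B *\<^sub>v v) = p \<bullet> (A *\<^sub>v \<xi>) + p \<bullet> (B *\<^sub>v v)"
    using A B p \<xi> vc by (intro scalar_prod_add_distrib) auto
  ultimately show ?thesis using ric' ywv unfolding p_def[symmetric] by linarith
qed

lemma has_derivative_mat_mult_vec:
  fixes Z :: "real mat"
  assumes Z: "Z \<in> carrier_mat r k" and c: "\<And>t. \<xi> t \<in> carrier_vec k" "\<And>t. \<eta> t \<in> carrier_vec k"
    and d: "\<And>i t. i < k \<Longrightarrow> ((\<lambda>t. \<xi> t $ i) has_real_derivative \<eta> t $ i) (at t)" and i: "i < r"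
  shows "((\<lambda>t. (Z *\<^sub>v \<xi> t) $ i) has_real_derivative (Z *\<^sub>v \<eta> t) $ i) (at t)"
proof -
  have *: "(Z *\<^sub>v w) $ i = (\<Sum>j<k. Z $$ (i, j) * w $ j)" if "w \<in> carrier_vec k" for w
    using Z i that by (auto simp: scalar_prod_def atLeast0LessThan intro!: sum.cong)
  show ?thesis unfolding *[OF c(1)] *[OF c(2)]
    by (intro DERIV_sum DERIV_cmult d) auto
qed

lemma quadratic_form_nonincreasing:
  fixes P :: "real mat"
  assumes P: "P \<in> carrier_mat k k" "transpose_mat P = P"
    and c: "\<And>t. \<xi> t \<in> carrier_vec k" "\<And>t. \<eta> t \<in> carrier_vec k"
    and d: "\<And>i t. i < k \<Longrightarrow> ((\<lambda>t. \<xi> t $ i) has_real_derivative \<eta> t $ i) (at t)"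
    and dissip: "\<And>t. (P *\<^sub>v \<xi> t) \<bullet> \<eta> t \<le> 0" and st: "s \<le> t"
  shows "\<xi> t \<bullet> (P *\<^sub>v \<xi> t) \<le> \<xi> s \<bullet> (P *\<^sub>v \<xi> s)"
proof (rule DERIV_nonpos_imp_nonincreasing[OF st, of "\<lambda>t. \<xi> t \<bullet> (P *\<^sub>v \<xi> t)"])
  fix t
  have sp: "v \<bullet> w = (\<Sum>i<k. v $ i * w $ i)" if "w \<in> carrier_vec k" for v w :: "real Matrix.vec"
    using that by (simp add: scalar_prod_def atLeast0LessThan)
  have Pc: "P *\<^sub>v w \<in> carrier_vec k" if "w \<in> carrier_vec k" for w using P(1) that by simp
  have "((\<lambda>t. \<Sum>i<k. \<xi> t $ i * (P *\<^sub>v \<xi> t) $ i) has_real_derivative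
      (\<Sum>i<k. \<eta> t $ i * (P *\<^sub>v \<xi> t) $ i + (P *\<^sub>v \<eta> t) $ i * \<xi> t $ i)) (at t)"
    by (intro DERIV_sum DERIV_mult d has_derivative_mat_mult_vec[OF P(1)] c) auto
  moreover have "(\<Sum>i<k. \<eta> t $ i * (P *\<^sub>v \<xi> t) $ i + (P *\<^sub>v \<eta> t) $ i * \<xi> t $ i)
      = \<eta> t \<bullet> (P *\<^sub>v \<xi> t) + (P *\<^sub>v \<eta> t) \<bullet> \<xi> t"
    by (simp add: sp Pc c sum.distrib)
  moreover have "\<eta> t \<bullet> (P *\<^sub>v \<xi> t) = (P *\<^sub>v \<xi> t) \<bullet> \<eta> t" using c Pc by (intro comm_scalar_prod) auto
  moreover have "(P *\<^sub>v \<eta> t) \<bullet> \<xi> t = \<eta> t \<bullet> (P *\<^sub>v \<xi> t)"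
    using symmetric_scalar_prod[OF P c(2) c(1)] by simp
  ultimately have "((\<lambda>t. \<xi> t \<bullet> (P *\<^sub>v \<xi> t)) has_real_derivative 2 * ((P *\<^sub>v \<xi> t) \<bullet> \<eta> t)) (at t)"
    using sp[OF Pc[OF c(1)]] by simp
  moreover have "2 * ((P *\<^sub>v \<xi> t) \<bullet> \<eta> t) \<le> 0" using dissip[of t] by simp
  ultimately show "\<exists>y. ((\<lambda>t. \<xi> t \<bullet> (P *\<^sub>v \<xi> t)) has_real_derivative y) (at t) \<and> y \<le> 0" by blast
qed

text \<open>
  The closed loop \<open>\<xi>' = C \<xi>\<close> has a smooth solution through every point. Its image under \<open>(M1, M2)\<close> lies
  in the behaviour because \<open>E M1 = N\<close> intertwines the two equations, and it stays in the image of the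
  sublevel set because \<open>\<xi> \<bullet> P \<xi>\<close> does not increase.
\<close>

lemma sublevel_set_controlled_forward_invariant:
  fixes E A B C N P M1 M2 :: "real mat"
  assumes E: "E \<in> carrier_mat l n" and A: "A \<in> carrier_mat l n" and B: "B \<in> carrier_mat l m"
    and M1: "M1 \<in> carrier_mat n k" and M2: "M2 \<in> carrier_mat m k" and C: "C \<in> carrier_mat k k"
    and N: "N \<in> carrier_mat l k"
    and lift: "\<And>\<xi>. \<xi> \<in> carrier_vec k \<Longrightarrow>
      E *\<^sub>v (M1 *\<^sub>v \<xi>) = N *\<^sub>v \<xi> \<and> A *\<^sub>v (M1 *\<^sub>v \<xi>) + B *\<^sub>v (M2 *\<^sub>v \<xi>) = N *\<^sub>v (C *\<^sub>v \<xi>)"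
    and P: "P \<in> carrier_mat k k" "transpose_mat P = P"
    and dissip: "\<And>\<xi>. \<xi> \<in> carrier_vec k \<Longrightarrow> (P *\<^sub>v \<xi>) \<bullet> (C *\<^sub>v \<xi>) \<le> 0"
  shows "controlled_forward_invariant E A B {M1 *\<^sub>v \<xi> | \<xi>. \<xi> \<in> carrier_vec k \<and> \<xi> \<bullet> (P *\<^sub>v \<xi>) \<le> \<rho>}"
    (is "controlled_forward_invariant E A B ?X")
  unfolding controlled_forward_invariant_def
proof (intro conjI ballI)
  show "?X \<subseteq> carrier_vec (dim_col E)" using E M1 by auto
  fix x0 assume "x0 \<in> ?X"
  then obtain \<xi>0 where \<xi>0: "\<xi>0 \<in> carrier_vec k" "\<xi>0 \<bullet> (P *\<^sub>v \<xi>0) \<le> \<rho>" "x0 = M1 *\<^sub>v \<xi>0" by auto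
  obtain \<xi> where \<xi>: "\<And>t. \<xi> t \<in> carrier_vec k" "\<xi> 0 = \<xi>0"
    "\<And>i t. i < k \<Longrightarrow> ((\<lambda>t. \<xi> t $ i) has_real_derivative (C *\<^sub>v \<xi> t) $ i) (at t)"
    using linear_ode_solution[OF C \<xi>0(1)] by blast
  have C\<xi>: "C *\<^sub>v \<xi> t \<in> carrier_vec k" for t using C \<xi>(1) by simp
  have deriv: "((\<lambda>t. (Z *\<^sub>v \<xi> t) $ i) has_real_derivative (Z *\<^sub>v (C *\<^sub>v \<xi> t)) $ i) (at t)"
    if "Z \<in> carrier_mat r k" "i < r" for Z r i t
    using that \<xi> C\<xi> by (intro has_derivative_mat_mult_vec) auto
  have cont: "continuous_on S (\<lambda>t. (Z *\<^sub>v \<xi> t) $ i)" if "Z \<in> carrier_mat r k" "i < r" for Z r i S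
    by (rule DERIV_continuous_on) (rule has_field_derivative_at_within[OF deriv[OF that]])
  have contC: "continuous_on S (\<lambda>t. (N *\<^sub>v (C *\<^sub>v \<xi> t)) $ i)" if "i < l" for i S
  proof -
    have "N * C \<in> carrier_mat l k" using N C by simp
    from cont[OF this that] show ?thesis
      using assoc_mult_mat_vec[OF N C \<xi>(1)] by simp
  qed
  let ?x = "\<lambda>t. M1 *\<^sub>v \<xi> t" and ?u = "\<lambda>t. M2 *\<^sub>v \<xi> t"
  have Ex: "E *\<^sub>v ?x t = N *\<^sub>v \<xi> t" for t using lift[OF \<xi>(1)] by blast
  have AB: "A *\<^sub>v ?x t + B *\<^sub>v ?u t = N *\<^sub>v (C *\<^sub>v \<xi> t)" for t using lift[OF \<xi>(1)] by blast
  have wd: "weak_derivative (\<lambda>t. (N *\<^sub>v \<xi> t) $ i) (\<lambda>t. (N *\<^sub>v (C *\<^sub>v \<xi> t)) $ i)" if "i < l" for i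
    by (rule weak_derivative_classical) (rule deriv[OF N that], rule contC[OF that])
  have L: "L1loc_vec r (\<lambda>t. Z *\<^sub>v \<xi> t)" if "Z \<in> carrier_mat r k" for Z r
    unfolding L1loc_vec_def using mult_mat_vec_carrier[OF that \<xi>(1)] L1loc_continuous[OF cont[OF that]] by blast
  have z: "L1loc_vec l (\<lambda>t. N *\<^sub>v (C *\<^sub>v \<xi> t))"
    unfolding L1loc_vec_def using mult_mat_vec_carrier[OF N C\<xi>] L1loc_continuous[OF contC] by blast
  have beh: "(?x, ?u) \<in> behaviour E A B"
  proof -
    have "W11loc_vec l (\<lambda>t. E *\<^sub>v ?x t)"
      unfolding W11loc_vec_def W11loc_def Ex
      using L[OF N] z wd unfolding L1loc_vec_def by blast
    moreover have "weak_derivative_vec l (\<lambda>t. E *\<^sub>v ?x t) (\<lambda>t. N *\<^sub>v (C *\<^sub>v \<xi> t))"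
      unfolding weak_derivative_vec_def Ex using wd by blast
    moreover have "AE t in lebesgue. 0 \<le> t \<longrightarrow> N *\<^sub>v (C *\<^sub>v \<xi> t) = A *\<^sub>v ?x t + B *\<^sub>v ?u t"
      unfolding AB by simp
    ultimately show ?thesis
      unfolding behaviour_def using L[OF M1] L[OF M2] z E B by auto
  qed
  have ic: "initial_cond E ?x x0"
  proof -
    have "continuous_rep (\<lambda>s. (N *\<^sub>v \<xi> s) $ i) 0 = (N *\<^sub>v \<xi> 0) $ i" if "i < l" for i
      by (rule continuous_rep_unique) (use cont[OF N that] in auto)
    moreover have "E *\<^sub>v x0 = N *\<^sub>v \<xi> 0" using Ex[of 0] \<xi>(2) \<xi>0(3) by simp
    ultimately show ?thesis
      unfolding initial_cond_def eval_vec_def Ex using E N by (intro eq_vecI) auto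
  qed
  have "?x t \<in> ?X" if "0 \<le> t" for t
  proof -
    have "\<xi> t \<bullet> (P *\<^sub>v \<xi> t) \<le> \<xi> 0 \<bullet> (P *\<^sub>v \<xi> 0)"
      using quadratic_form_nonincreasing[OF P \<xi>(1) C\<xi> \<xi>(3) _ that] dissip[OF \<xi>(1)] by blast
    then have "\<xi> t \<bullet> (P *\<^sub>v \<xi> t) \<le> \<rho>" using \<xi>(2) \<xi>0(2) by simp
    then show ?thesis using \<xi>(1) by blast
  qed
  then have "AE t in lebesgue. 0 \<le> t \<longrightarrow> ?x t \<in> ?X" by simp
  with beh ic show "\<exists>(x, u) \<in> behaviour E A B. initial_cond E x x0 \<and> (AE t in lebesgue. 0 \<le> t \<longrightarrow> x t \<in> ?X)"
    by blast
qed

theorem theorem18: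
  fixes l n m p nh r q :: nat
    and E A B S F G T U1 U0 A11 A12 A21 A22 B1 B2 :: "real mat"
    and Ah Bh X Sh Qh Hh Rh Ph M :: "real mat"
    and \<rho> :: real
    and Xf :: "real Matrix.vec set"
    and Vf :: "real Matrix.vec \<Rightarrow> ereal"
  assumes "E \<in> carrier_mat l n" and "A \<in> carrier_mat l n" and "B \<in> carrier_mat l m"
    and "S \<in> carrier_mat (n + m) (n + m)" and "transpose_mat S = S"
    and "F \<in> carrier_mat p n" and "G \<in> carrier_mat p m"
    and "regularizing_transformation l n m E A B T nh r U1 U0 A11 A12 A21 A22 B1 B2"
    and "q = n + m - r"
    and "Ah = A11 - A12 * mat_inv A22 * A21"
    and "Bh = B1 - A12 * mat_inv A22 * B2"
    and "X = T * (four_block_mat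
                    (1\<^sub>m nh)                (0\<^sub>m nh q)
                    (- (mat_inv A22 * A21)) (- (mat_inv A22 * B2))
                  @\<^sub>r append_cols (0\<^sub>m q nh) (1\<^sub>m q))"
    and "Sh = transpose_mat X * S * X"
    and "Qh \<in> carrier_mat nh nh" and "Hh \<in> carrier_mat nh q" and "Rh \<in> carrier_mat q q"
    and "Sh = four_block_mat Qh Hh (transpose_mat Hh) Rh"
    (* standing assumption *)
    and "pos_semidef Sh" and "stabilizable Ah Bh" and "pos_def Rh" and "observable Ah Qh"
    and "mat_rank Sh = mat_rank Qh + mat_rank Rh"
    (* algebraic Riccati equation *)
    and "Ph \<in> carrier_mat nh nh" and "pos_def Ph"
    and "transpose_mat Ah * Ph + Ph * Ah + Qh
           - (Ph * Bh + Hh) * mat_inv Rh * transpose_mat (Ph * Bh + Hh) = 0\<^sub>m nh nh"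
    and "M = X * (1\<^sub>m nh @\<^sub>r (- (mat_inv Rh * (transpose_mat Bh * Ph + transpose_mat Hh))))"
    and "append_cols F G * M \<noteq> 0\<^sub>m p nh"
    and "\<rho> = lambda_min Ph / (row_sum_norm (append_cols F G * M))\<^sup>2"
    and "Xf = {append_cols (1\<^sub>m n) (0\<^sub>m n m) * M *\<^sub>v xh | xh.
                 xh \<in> carrier_vec nh \<and> scalar_prod xh (Ph *\<^sub>v xh) \<le> \<rho>}"
    and "Vf = V_inf E A B S"
  shows "\<rho> > 0 \<and>
    controlled_forward_invariant E A B Xf \<and>
    (\<forall>xh \<in> consistent_initial E A B. \<forall>(x, u) \<in> behaviour E A B.
       initial_cond E x xh \<and> J_inf S x u = V_inf E A B S xh \<longrightarrow>
       (AE \<delta> in lebesgue. \<delta> > 0 \<longrightarrow>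
          x \<delta> \<in> consistent_initial E A B \<and>
          Vf (x \<delta>) \<le> Vf xh - cost_on {0..\<delta>} S x u))"
proof -
  note E = assms(1) and A = assms(2) and B = assms(3) and S = assms(4) and reg = assms(8)
    and q = assms(9) and Ah = assms(10) and Bh = assms(11) and X = assms(12)
    and Q = assms(14) and H = assms(15) and R = assms(16) and P = assms(23) and pdP = assms(24)
    and M = assms(26)
  have sym: "transpose_mat Ph = Ph" using pdP unfolding pos_def_def by simp
  have dims: "nh \<le> r" "r \<le> n + m" and T: "T \<in> carrier_mat (n + m) (n + m)"
    and A11: "A11 \<in> carrier_mat nh nh" and A12: "A12 \<in> carrier_mat nh (r - nh)"
    and A21: "A21 \<in> carrier_mat (r - nh) nh" and A22: "A22 \<in> carrier_mat (r - nh) (r - nh)"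
    and inv: "invertible_mat A22"
    and B1: "B1 \<in> carrier_mat nh q" and B2: "B2 \<in> carrier_mat (r - nh) q"
    using reg unfolding regularizing_transformation_def q by auto
  have Ai: "mat_inv A22 \<in> carrier_mat (r - nh) (r - nh)"
    by (rule mat_inv_of_det_nonzero(2)[OF A22 det_nonzero_of_invertible[OF A22 inv]])
  have Ahc: "Ah \<in> carrier_mat nh nh" and Bhc: "Bh \<in> carrier_mat nh q"
    using A11 A12 Ai A21 B1 B2 unfolding Ah Bh by auto
  have Xc: "X \<in> carrier_mat (n + m) (nh + q)"
  proof -
    have Y1: "four_block_mat (1\<^sub>m nh) (0\<^sub>m nh q) (- (mat_inv A22 * A21)) (- (mat_inv A22 * B2))
        \<in> carrier_mat (nh + (r - nh)) (nh + q)"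
      using Ai A21 B2 by (intro four_block_carrier_mat) auto
    have Y2: "append_cols (0\<^sub>m q nh) (1\<^sub>m q :: real mat) \<in> carrier_mat q (nh + q)" by auto
    have "nh + (r - nh) + q = n + m" using dims by (simp add: q)
    then show ?thesis unfolding X using carrier_append_rows[OF Y1 Y2] T by auto
  qed
  define K where "K = mat_inv Rh * (transpose_mat Bh * Ph + transpose_mat Hh)"
  have Kc: "K \<in> carrier_mat q nh"
    using mat_inv_of_det_nonzero(2)[OF R det_nonzero_of_pos_def[OF R assms(20)]] Bhc P H by (auto simp: K_def)
  have IK: "1\<^sub>m nh @\<^sub>r - K \<in> carrier_mat (nh + q) nh" using Kc by auto
  have M': "M = X * (1\<^sub>m nh @\<^sub>r - K)" using M by (simp add: K_def)
  have Mc: "M \<in> carrier_mat (n + m) nh" unfolding M' using Xc IK by auto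
  let ?M1 = "append_cols (1\<^sub>m n) (0\<^sub>m n m) * M" and ?M2 = "append_cols (0\<^sub>m m n) (1\<^sub>m m) * M"
  have M12: "?M1 \<in> carrier_mat n nh" "?M2 \<in> carrier_mat m nh"
    by (rule mult_carrier_mat[OF append_cols_carrier[OF one_carrier_mat zero_carrier_mat] Mc])
      (rule mult_carrier_mat[OF append_cols_carrier[OF zero_carrier_mat one_carrier_mat] Mc])
  have FG: "append_cols F G * M \<in> carrier_mat p nh" 
    by (rule mult_carrier_mat[OF append_cols_carrier[OF assms(6,7)] Mc])
  \<comment> \<open>A matrix without columns is zero, so \<open>[F G] M \<noteq> 0\<close> gives \<open>nh > 0\<close> and \<open>lambda_min\<close> is the minimum of a nonempty set.\<close>
  have "0 < nh"
  proof (rule ccontr)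
    assume "\<not> 0 < nh"
    then have "append_cols F G * M = 0\<^sub>m p nh" using FG by (intro eq_matI) auto
    with assms(27) show False by simp
  qed
  then have rho: "0 < \<rho>"
    using lambda_min_pos[OF P _ pdP] row_sum_norm_pos[OF FG assms(27)] unfolding assms(28) by simp
  obtain N where N: "N \<in> carrier_mat l nh"
    and lift: "\<And>\<xi> v x u. \<lbrakk>\<xi> \<in> carrier_vec nh; v \<in> carrier_vec q; x \<in> carrier_vec n; u \<in> carrier_vec m;
       X *\<^sub>v (\<xi> @\<^sub>v v) = x @\<^sub>v u\<rbrakk>
     \<Longrightarrow> E *\<^sub>v x = N *\<^sub>v \<xi> \<and> A *\<^sub>v x + B *\<^sub>v u = N *\<^sub>v (Ah *\<^sub>v \<xi> + Bh *\<^sub>v v)"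
    using regularized_system_equation[OF E A B reg q Ah Bh X] by blast
  \<comment> \<open>the closed-loop matrix of the optimal feedback \<open>v = - K \<xi>\<close>\<close>
  define C where "C = Ah + Bh * - K"
  have Cc: "C \<in> carrier_mat nh nh" using Ahc Bhc Kc by (simp add: C_def)
  have C\<xi>: "C *\<^sub>v \<xi> = Ah *\<^sub>v \<xi> + Bh *\<^sub>v (- K *\<^sub>v \<xi>)" if "\<xi> \<in> carrier_vec nh" for \<xi>
  proof -
    have K': "- K \<in> carrier_mat q nh" using Kc by simp
    show ?thesis
      unfolding C_def add_mult_distrib_mat_vec[OF Ahc mult_carrier_mat[OF Bhc K'] that]
        assoc_mult_mat_vec[OF Bhc K' that] ..
  qed
  have inv: "controlled_forward_invariant E A B
      {?M1 *\<^sub>v \<xi> | \<xi>. \<xi> \<in> carrier_vec nh \<and> \<xi> \<bullet> (Ph *\<^sub>v \<xi>) \<le> \<rho>}"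
  proof (rule sublevel_set_controlled_forward_invariant[OF E A B M12 Cc N _ P sym])
    fix \<xi> :: "real Matrix.vec" assume \<xi>: "\<xi> \<in> carrier_vec nh"
    have K\<xi>: "- K *\<^sub>v \<xi> \<in> carrier_vec q" using Kc \<xi> by auto
    have "X *\<^sub>v (\<xi> @\<^sub>v (- K *\<^sub>v \<xi>)) = M *\<^sub>v \<xi>"
    proof -
      have "M *\<^sub>v \<xi> = X *\<^sub>v ((1\<^sub>m nh @\<^sub>r - K) *\<^sub>v \<xi>)" unfolding M' by (rule assoc_mult_mat_vec[OF Xc IK \<xi>])
      also have "(1\<^sub>m nh @\<^sub>r - K) *\<^sub>v \<xi> = \<xi> @\<^sub>v (- K *\<^sub>v \<xi>)"
        using Kc \<xi> by (subst mat_mult_append[of _ nh nh _ q]) auto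
      finally show ?thesis by simp
    qed
    moreover have "M *\<^sub>v \<xi> = (?M1 *\<^sub>v \<xi>) @\<^sub>v (?M2 *\<^sub>v \<xi>)"
    proof -
      define x where "x = vec_first (M *\<^sub>v \<xi>) n"
      define u where "u = vec_last (M *\<^sub>v \<xi>) m"
      have xu: "x \<in> carrier_vec n" "u \<in> carrier_vec m" "M *\<^sub>v \<xi> = x @\<^sub>v u"
        using Mc \<xi> by (simp_all add: x_def u_def)
      have "?M1 *\<^sub>v \<xi> = append_cols (1\<^sub>m n) (0\<^sub>m n m) *\<^sub>v (x @\<^sub>v u)"
        unfolding xu(3)[symmetric] using Mc \<xi> by (intro assoc_mult_mat_vec[of _ n "n + m" _ nh]) auto
      also have "\<dots> = x" using xu
        by (simp add: append_cols_mult_vec[OF one_carrier_mat zero_carrier_mat] zero_mult_mat_vec)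
      finally have 1: "?M1 *\<^sub>v \<xi> = x" .
      have "?M2 *\<^sub>v \<xi> = append_cols (0\<^sub>m m n) (1\<^sub>m m) *\<^sub>v (x @\<^sub>v u)"
        unfolding xu(3)[symmetric] using Mc \<xi> by (intro assoc_mult_mat_vec[of _ m "n + m" _ nh]) auto
      also have "\<dots> = u" using xu
        by (simp add: append_cols_mult_vec[OF zero_carrier_mat one_carrier_mat] zero_mult_mat_vec)
      finally show ?thesis using 1 xu(3) by simp
    qed
    ultimately have "X *\<^sub>v (\<xi> @\<^sub>v (- K *\<^sub>v \<xi>)) = (?M1 *\<^sub>v \<xi>) @\<^sub>v (?M2 *\<^sub>v \<xi>)" by simp
    moreover have "?M1 *\<^sub>v \<xi> \<in> carrier_vec n" "?M2 *\<^sub>v \<xi> \<in> carrier_vec m"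
      using mult_mat_vec_carrier[OF M12(1) \<xi>] mult_mat_vec_carrier[OF M12(2) \<xi>] .
    ultimately show "E *\<^sub>v (?M1 *\<^sub>v \<xi>) = N *\<^sub>v \<xi> \<and>
        A *\<^sub>v (?M1 *\<^sub>v \<xi>) + B *\<^sub>v (?M2 *\<^sub>v \<xi>) = N *\<^sub>v (C *\<^sub>v \<xi>)"
      using lift[OF \<xi> K\<xi>] unfolding C\<xi>[OF \<xi>] by blast
    show "(Ph *\<^sub>v \<xi>) \<bullet> (C *\<^sub>v \<xi>) \<le> 0"
      unfolding C\<xi>[OF \<xi>]
      by (rule riccati_feedback_dissipative[OF Ahc Bhc Q H R P assms(20) sym _ assms(25) \<xi>])
        (use assms(17,18) K_def in auto)
  qed
  show ?thesis
    using rho inv V_inf_decrease_along_optimal[OF carrier_matD(2)[OF E] carrier_matD(2)[OF B] S]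
    unfolding assms(29,30) by blast
qed

end
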